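(* Let $n\geqslant2$, $p\geqslant1$, let $Q:\mathbb{B}^n\to[0,\infty]$ be a Lebesgue measurable function, and let $f:\mathbb{B}^n\to\mathbb{B}^n$ be an open discrete ring $(p,Q)$-mapping with $f(0)=0$. Suppose that $q_0(r)\neq\infty$ for a.e. $r\in(0,1)$ and that, for some constant $c>0$, $$\int_{r<|x|<1}Q(x)\,\psi^p(|x|)\,dm(x)\leqslant c\,J^{\alpha}(r)\qquad\text{for all } r\in(0,1),$$ where $\alpha\leqslant p$ and $\psi$ is a nonnegative Lebesgue measurable function on $(0,\infty)$ such that $$0<J(r)=\int_r^1\psi(t)\,dt<\infty\qquad\text{for all } r\in(0,1).$$ Then, if $1<p<n$, $$\liminf_{x\to0}\,|f(x)|\cdot\left(1+\beta J^{\frac{p-\alpha}{p-1}}(|x|)\right)^{\frac{p-1}{n-p}}\leqslant1,\qquad \beta=\frac{n-p}{p-1}\left(\frac{\omega_{n-1}}{c}\right)^{\frac{1}{p-1}};$$ and if $p=n$, $$\liminf_{x\to0}\,|f(x)|\cdot\exp\left\{\frac{\gamma}{n}J^{\frac{n-\alpha}{n-1}}(|x|)\right\}\leqslant1,\qquad \gamma=n\left(\frac{\omega_{n-1}}{c}\right)^{\frac{1}{n-1}}.$$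
   Context: Notation: $m$ is Lebesgue measure in $\mathbb{R}^n$; $B(x_0,r)=\{x\in\mathbb{R}^n:|x-x_0|<r\}$, $S(x_0,r)=\{x\in\mathbb{R}^n:|x-x_0|=r\}$, $A(r_1,r_2,x_0)=\{x\in\mathbb{R}^n:r_1<|x-x_0|<r_2\}$, $\mathbb{B}^n=B(0,1)$, $\omega_{n-1}$ is the area of the unit sphere $S(0,1)$. Mappings are continuous. A mapping is open if images of open sets are open, and discrete if the preimage of every point consists of isolated points. With $\mathcal{H}^{n-1}$ the $(n-1)$-dimensional Hausdorff measure, $$q_{0}(r)=\frac{1}{\omega_{n-1}r^{n-1}}\int_{S(0,r)}Q(x)\,d\mathcal{H}^{n-1}.$$ A curve is a continuous map of an interval; for a family of curves $\Gamma$, $f(\Gamma)=\{f\circ\gamma:\gamma\in\Gamma\}$. $\Gamma(E,F,G)$ is the family of all curves $\gamma:[a,b]\to\overline{\mathbb{R}^n}=\mathbb{R}^n\cup\{\infty\}$ with $\gamma(a)\in E$, $\gamma(b)\in F$ and $\gamma(t)\in G$ for $t\in(a,b)$. A Borel function $\rho:\mathbb{R}^n\to[0,\infty]$ is admissible for $\Gamma$ if $\int_\gamma\rho\,|dx|\geqslant 1$ for all (locally rectifiable) $\gamma\in\Gamma$. The $p$-modulus ($p\geqslant1$) is $M_p(\Gamma)=\inf_\rho\int_{\mathbb{R}^n}\rho^p\,dm$, the infimum being over all admissible $\rho$. Let $D$ be a domain in $\mathbb{R}^n$, $Q:D\to[0,\infty]$ Lebesgue measurable and $x_0\in D$. A mapping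 $f$ defined on $D$ is a ring $(p,Q)$-mapping at $x_0$ if for all $0<r_1<r_2<\mathrm{dist}(x_0,\partial D)$, with $S_i=S(x_0,r_i)$ and $A=A(r_1,r_2,x_0)$, $$M_p\big(f(\Gamma(S_1,S_2,A))\big)\leqslant\int_A Q(x)\,\eta^p(|x-x_0|)\,dm(x)$$ for every Lebesgue measurable $\eta:(r_1,r_2)\to[0,\infty]$ with $\int_{r_1}^{r_2}\eta(r)\,dr\geqslant1$. It is a ring $(p,Q)$-mapping (in $D$) if this holds at every point $x_0\in D$. Conventions: $a/\infty=0$ for $a\neq\infty$, $a/0=\infty$ for $a>0$, $0\cdot\infty=0$. *)

theory Defs
  imports "HOL-Analysis.Analysis"
begin

section \<open>Powers in \<open>[0,\<infinity>]\<close>\<close>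

text \<open>The power with real exponent on \<^typ>\<open>ennreal\<close>, meant for exponents \<open>p > 0\<close>.\<close>

definition epow :: "ennreal \<Rightarrow> real \<Rightarrow> ennreal" where
  "epow x p = (if x = \<infinity> then \<infinity> else ennreal (enn2real x powr p))"


section \<open>Hausdorff measure\<close>

text \<open>
  The \<open>d\<close>-dimensional Hausdorff measure for integer \<open>d\<close>, normalised so that it agrees with
  Lebesgue measure when \<open>d\<close> is the dimension of the space. Covering sets must be required to be
  bounded since \<^const>\<open>diameter\<close> is unspecified on unbounded sets; the empty set is treated
  separately so that the case \<open>d = 0\<close> (counting measure) is covered, too.
\<close>

definition hausdorff_pre :: "nat \<Rightarrow> real \<Rightarrow> 'a::metric_space set \<Rightarrow> ennreal" where
  "hausdorff_pre d \<delta> A =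
     (INF U\<in>{U :: nat \<Rightarrow> 'a set. A \<subseteq> (\<Union>i. U i) \<and> (\<forall>i. bounded (U i) \<and> diameter (U i) \<le> \<delta>)}.
        \<Sum>i. if U i = {} then 0 else ennreal (unit_ball_vol (real d) * (diameter (U i) / 2) ^ d))"

definition hausdorff_outer :: "nat \<Rightarrow> 'a::metric_space set \<Rightarrow> ennreal" where
  "hausdorff_outer d A = (SUP \<delta>\<in>{0<..}. hausdorff_pre d \<delta> A)"

definition hausdorff_measure :: "nat \<Rightarrow> 'a::metric_space measure" where
  "hausdorff_measure d =
     measure_of UNIV (lambda_system UNIV UNIV (hausdorff_outer d)) (hausdorff_outer d)"

text \<open>That this really is a measure, i.e. that \<^const>\<open>measure_of\<close> does not take its default value:\<close>

lemma outer_measure_space_hausdorff_outer: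
  "outer_measure_space UNIV (hausdorff_outer d :: 'a::metric_space set \<Rightarrow> ennreal)"
proof -
  define g :: "real \<Rightarrow> 'a set \<Rightarrow> ennreal" where
    "g \<delta> U = (if U = {} then 0
              else if bounded U \<and> diameter U \<le> \<delta>
                then ennreal (unit_ball_vol (real d) * (diameter U / 2) ^ d) else \<infinity>)" for \<delta> U
  have R: "ring_of_sets (UNIV :: 'a set) (Pow UNIV)"
    by (simp add: ring_of_setsI)
  have pos: "positive (Pow UNIV) (g \<delta>)" for \<delta>
    by (simp add: positive_def g_def)
  have inc: "increasing (Pow UNIV) (g \<delta>)" for \<delta>
    unfolding increasing_def
  proof (intro ballI impI)
    fix x y :: "'a set" assume xy: "x \<subseteq> y"
    show "g \<delta> x \<le> g \<delta> y"
    proof (cases "x = {} \<or> \<not> (bounded y \<and> diameter y \<le> \<delta>)")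
      case True
      then show ?thesis using xy by (auto simp: g_def)
    next
      case False
      then have y: "bounded y" "diameter y \<le> \<delta>" "x \<noteq> {}" "y \<noteq> {}" using xy by auto
      have x: "bounded x" "diameter x \<le> diameter y"
        using xy y bounded_subset diameter_subset by blast+
      have "unit_ball_vol (real d) * (diameter x / 2) ^ d \<le> unit_ball_vol (real d) * (diameter y / 2) ^ d"
        using x y by (intro mult_left_mono power_mono) (auto simp: diameter_ge_0)
      then show ?thesis using x y by (auto simp: g_def intro!: ennreal_leI)
    qed
  qed
  have eq: "hausdorff_pre d \<delta> A = outer_measure (Pow UNIV) (g \<delta>) A" if "\<delta> > 0" for \<delta> A
  proof (rule antisym)
    show "hausdorff_pre d \<delta> A \<le> outer_measure (Pow UNIV) (g \<delta>) A"
      unfolding outer_measure_def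
    proof (rule INF_greatest)
      fix U :: "nat \<Rightarrow> 'a set"
      assume "U \<in> {U. range U \<subseteq> Pow UNIV \<and> disjoint_family U \<and> A \<subseteq> \<Union> (range U)}"
      then have U: "A \<subseteq> (\<Union>i. U i)" by auto
      show "hausdorff_pre d \<delta> A \<le> (\<Sum>i. g \<delta> (U i))"
      proof (cases "\<forall>i. bounded (U i) \<and> diameter (U i) \<le> \<delta>")
        case True
        then show ?thesis
          unfolding hausdorff_pre_def using U
          by (intro INF_lower2[of U] suminf_le summableI) (auto simp: g_def)
      next
        case False
        then obtain i where "\<not> (bounded (U i) \<and> diameter (U i) \<le> \<delta>)" by blast
        then have "g \<delta> (U i) = \<infinity>" using that by (auto simp: g_def)
        moreover have "g \<delta> (U i) \<le> (\<Sum>i. g \<delta> (U i))"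
          using sum_le_suminf[of "\<lambda>i. g \<delta> (U i)" "{i}"] by (simp add: summableI)
        ultimately show ?thesis by (simp add: top_unique)
      qed
    qed
    show "outer_measure (Pow UNIV) (g \<delta>) A \<le> hausdorff_pre d \<delta> A"
      unfolding hausdorff_pre_def
    proof (rule INF_greatest)
      fix U :: "nat \<Rightarrow> 'a set"
      assume "U \<in> {U. A \<subseteq> (\<Union>i. U i) \<and> (\<forall>i. bounded (U i) \<and> diameter (U i) \<le> \<delta>)}"
      then have U: "A \<subseteq> (\<Union>i. U i)" "\<forall>i. bounded (U i) \<and> diameter (U i) \<le> \<delta>" by auto
      have "outer_measure (Pow UNIV) (g \<delta>) A \<le> (\<Sum>i. g \<delta> (U i))"
        by (rule ring_of_sets.outer_measure_le[OF R pos inc _ U(1)]) simp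
      also have "(\<lambda>i. g \<delta> (U i)) =
          (\<lambda>i. if U i = {} then 0 else ennreal (unit_ball_vol (real d) * (diameter (U i) / 2) ^ d))"
        using U(2) by (auto simp: g_def)
      finally show "outer_measure (Pow UNIV) (g \<delta>) A \<le>
          (\<Sum>i. if U i = {} then 0 else ennreal (unit_ball_vol (real d) * (diameter (U i) / 2) ^ d))" .
    qed
  qed
  have om: "outer_measure_space (Pow UNIV) (outer_measure (Pow UNIV) (g \<delta>))" for \<delta>
    by (rule ring_of_sets.outer_measure_space_outer_measure[OF R pos inc])
  have ho: "hausdorff_outer d A = (SUP \<delta>\<in>{0<..}. outer_measure (Pow UNIV) (g \<delta>) A)" for A :: "'a set"
    unfolding hausdorff_outer_def by (intro SUP_cong refl eq) simp
  show ?thesis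
    unfolding outer_measure_space_def
  proof (intro conjI)
    show "positive UNIV (hausdorff_outer d :: 'a set \<Rightarrow> ennreal)"
    proof -
      have "(1::real) \<in> {0<..}" by simp
      then have "{0::real<..} \<noteq> {}" by blast
      then show ?thesis
        using om by (simp add: ho outer_measure_space_def positive_def)
    qed
    show "increasing UNIV (hausdorff_outer d :: 'a set \<Rightarrow> ennreal)"
      unfolding increasing_def ho using om
      by (auto simp: outer_measure_space_def increasing_def intro!: SUP_mono')
    show "countably_subadditive UNIV (hausdorff_outer d :: 'a set \<Rightarrow> ennreal)"
      unfolding countably_subadditive_def
    proof (intro allI impI)
      fix A :: "nat \<Rightarrow> 'a set" assume A: "disjoint_family A"
      show "hausdorff_outer d (\<Union>i. A i) \<le> (\<Sum>i. hausdorff_outer d (A i))"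
        unfolding ho[of "\<Union>i. A i"]
      proof (rule SUP_least)
        fix \<delta> :: real assume \<delta>: "\<delta> \<in> {0<..}"
        have "outer_measure (Pow UNIV) (g \<delta>) (\<Union>i. A i) \<le> (\<Sum>i. outer_measure (Pow UNIV) (g \<delta>) (A i))"
          using om[of \<delta>] A by (auto simp: outer_measure_space_def countably_subadditive_def)
        also have "\<dots> \<le> (\<Sum>i. hausdorff_outer d (A i))"
          using \<delta> by (intro suminf_le summableI) (auto simp: ho intro: SUP_upper)
        finally show "outer_measure (Pow UNIV) (g \<delta>) (\<Union>i. A i) \<le> (\<Sum>i. hausdorff_outer d (A i))" .
      qed
    qed
  qed
qed

lemma
  fixes A :: "'a::metric_space set"
  shows sets_hausdorff_measure:
    "sets (hausdorff_measure d :: 'a measure) = lambda_system UNIV UNIV (hausdorff_outer d)" (is ?S)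
  and emeasure_hausdorff_measure:
    "A \<in> sets (hausdorff_measure d) \<Longrightarrow> emeasure (hausdorff_measure d) A = hausdorff_outer d A"
proof -
  have "measure_space UNIV (lambda_system UNIV UNIV (hausdorff_outer d))
          (hausdorff_outer d :: 'a set \<Rightarrow> ennreal)"
    using sigma_algebra.caratheodory_lemma[OF sigma_algebra_Pow[of "UNIV :: 'a set"], of "hausdorff_outer d"]
      outer_measure_space_hausdorff_outer[of d, where 'a='a]
    by simp
  then have ms: "sigma_algebra UNIV (lambda_system UNIV UNIV (hausdorff_outer d :: 'a set \<Rightarrow> ennreal))"
    "positive (lambda_system UNIV UNIV (hausdorff_outer d)) (hausdorff_outer d :: 'a set \<Rightarrow> ennreal)"
    "countably_additive (lambda_system UNIV UNIV (hausdorff_outer d)) (hausdorff_outer d :: 'a set \<Rightarrow> ennreal)"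
    by (auto simp: measure_space_def)
  show S: ?S
    unfolding hausdorff_measure_def
    by (simp add: sets_measure_of_conv sigma_algebra.sigma_sets_eq[OF ms(1)])
  show "A \<in> sets (hausdorff_measure d) \<Longrightarrow> emeasure (hausdorff_measure d) A = hausdorff_outer d A"
    unfolding S unfolding hausdorff_measure_def
    by (rule emeasure_measure_of_sigma[OF ms])
qed

text \<open>The area \<open>\<omega>\<^bsub>n-1\<^esub>\<close> of the unit sphere of an \<open>n\<close>-dimensional space.\<close>

definition unit_sphere_area :: "'a::euclidean_space itself \<Rightarrow> real" where
  "unit_sphere_area _ = measure (hausdorff_measure (DIM('a) - 1)) (sphere (0::'a) 1)"

definition spherical_mean :: "('a::euclidean_space \<Rightarrow> ennreal) \<Rightarrow> real \<Rightarrow> ennreal" where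
  "spherical_mean Q r =
     (\<integral>\<^sup>+x\<in>sphere 0 r. Q x \<partial>hausdorff_measure (DIM('a) - 1)) /
     ennreal (unit_sphere_area TYPE('a) * r ^ (DIM('a) - 1))"


section \<open>Curves and the modulus of a family of curves\<close>

text \<open>A curve is given by its interval of definition and a function that is continuous on that
  interval; values outside the interval are irrelevant.\<close>

type_synonym 'a curve = "real set \<times> (real \<Rightarrow> 'a)"

definition curve_length :: "(real \<Rightarrow> 'a::metric_space) \<Rightarrow> real \<Rightarrow> real \<Rightarrow> ennreal" where
  "curve_length \<gamma> a b =
     (SUP (n, t) \<in> {(n :: nat, t :: nat \<Rightarrow> real). t 0 = a \<and> t n = b \<and> (\<forall>i<n. t i \<le> t (Suc i))}.
        \<Sum>i<n. ennreal (dist (\<gamma> (t i)) (\<gamma> (t (Suc i)))))"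

text \<open>The normal (arc length) representation of a rectifiable \<open>\<gamma>\<close> on \<open>[a,b]\<close>: its value at \<open>s\<close> does
  not depend on the choice of \<open>t\<close>, as \<open>\<gamma>\<close> is constant wherever its length function is.\<close>

definition normal_representation :: "(real \<Rightarrow> 'a::metric_space) \<Rightarrow> real \<Rightarrow> real \<Rightarrow> real \<Rightarrow> 'a" where
  "normal_representation \<gamma> a b s = \<gamma> (SOME t. t \<in> {a..b} \<and> curve_length \<gamma> a t = ennreal s)"

definition line_integral :: "('a::metric_space \<Rightarrow> ennreal) \<Rightarrow> (real \<Rightarrow> 'a) \<Rightarrow> real \<Rightarrow> real \<Rightarrow> ennreal" where
  "line_integral \<rho> \<gamma> a b =
     (\<integral>\<^sup>+s\<in>{0..enn2real (curve_length \<gamma> a b)}. \<rho> (normal_representation \<gamma> a b s) \<partial>lborel)"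

definition locally_rectifiable :: "'a::metric_space curve \<Rightarrow> bool" where
  "locally_rectifiable = (\<lambda>(I, \<gamma>). \<forall>a b. a \<le> b \<and> {a..b} \<subseteq> I \<longrightarrow> curve_length \<gamma> a b < \<infinity>)"

definition curve_integral :: "('a::metric_space \<Rightarrow> ennreal) \<Rightarrow> 'a curve \<Rightarrow> ennreal" where
  "curve_integral \<rho> = (\<lambda>(I, \<gamma>). SUP (a, b) \<in> {(a, b). a \<le> b \<and> {a..b} \<subseteq> I}. line_integral \<rho> \<gamma> a b)"

definition admissible :: "'a::euclidean_space curve set \<Rightarrow> ('a \<Rightarrow> ennreal) \<Rightarrow> bool" where
  "admissible \<Gamma> \<rho> \<longleftrightarrow>
     \<rho> \<in> borel_measurable borel \<and> (\<forall>c\<in>\<Gamma>. locally_rectifiable c \<longrightarrow> 1 \<le> curve_integral \<rho> c)"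

definition modulus :: "real \<Rightarrow> 'a::euclidean_space curve set \<Rightarrow> ennreal" where
  "modulus p \<Gamma> = (INF \<rho>\<in>{\<rho>. admissible \<Gamma> \<rho>}. \<integral>\<^sup>+x. epow (\<rho> x) p \<partial>lebesgue)"

text \<open>The curves joining \<open>E\<close> and \<open>F\<close> in \<open>G\<close>. Since \<open>E\<close>, \<open>F\<close>, \<open>G\<close> are subsets of the finite space, such
  curves never pass through the point at infinity.\<close>

definition joining_curves :: "'a::euclidean_space set \<Rightarrow> 'a set \<Rightarrow> 'a set \<Rightarrow> 'a curve set" where
  "joining_curves E F G =
     {({a..b}, \<gamma>) | a b \<gamma>. a < b \<and> continuous_on {a..b} \<gamma> \<and>
        \<gamma> a \<in> E \<and> \<gamma> b \<in> F \<and> (\<forall>t\<in>{a<..<b}. \<gamma> t \<in> G)}"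

definition image_curves :: "('a \<Rightarrow> 'b) \<Rightarrow> 'a curve set \<Rightarrow> 'b curve set" where
  "image_curves f \<Gamma> = (\<lambda>(I, \<gamma>). (I, f \<circ> \<gamma>)) ` \<Gamma>"


section \<open>Ring mappings and open discrete mappings\<close>

definition annulus :: "real \<Rightarrow> real \<Rightarrow> 'a::metric_space \<Rightarrow> 'a set" where
  "annulus r1 r2 x0 = {x. r1 < dist x x0 \<and> dist x x0 < r2}"

text \<open>The distance to an empty boundary is infinite, whereas \<^term>\<open>infdist x {} = 0\<close>.\<close>

definition ring_mapping_at ::
  "real \<Rightarrow> ('a::euclidean_space \<Rightarrow> ennreal) \<Rightarrow> 'a set \<Rightarrow> ('a \<Rightarrow> 'a) \<Rightarrow> 'a \<Rightarrow> bool" where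
  "ring_mapping_at p Q D f x0 \<longleftrightarrow>
     (\<forall>r1 r2. 0 < r1 \<and> r1 < r2 \<and> (frontier D = {} \<or> r2 < infdist x0 (frontier D)) \<longrightarrow>
       (\<forall>\<eta> \<in> borel_measurable (lebesgue_on {r1<..<r2}).
          1 \<le> (\<integral>\<^sup>+r\<in>{r1<..<r2}. \<eta> r \<partial>lebesgue) \<longrightarrow>
          modulus p (image_curves f (joining_curves (sphere x0 r1) (sphere x0 r2) (annulus r1 r2 x0)))
            \<le> (\<integral>\<^sup>+x\<in>annulus r1 r2 x0. Q x * epow (\<eta> (dist x x0)) p \<partial>lebesgue)))"

text \<open>As all mappings are understood to be continuous, continuity is part of the notion.\<close>

definition ring_mapping ::
  "real \<Rightarrow> ('a::euclidean_space \<Rightarrow> ennreal) \<Rightarrow> 'a set \<Rightarrow> ('a \<Rightarrow> 'a) \<Rightarrow> bool" where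
  "ring_mapping p Q D f \<longleftrightarrow> continuous_on D f \<and> (\<forall>x0\<in>D. ring_mapping_at p Q D f x0)"

definition open_discrete_mapping :: "'a::euclidean_space set \<Rightarrow> ('a \<Rightarrow> 'a) \<Rightarrow> bool" where
  "open_discrete_mapping D f \<longleftrightarrow>
     open_map (top_of_set D) euclidean f \<and> (\<forall>y. discrete {x \<in> D. f x = y})"

end

theory Submission
  imports Defs
begin

text \<open>
  In fact for every \<open>r \<in> (0,1)\<close> some point of the sphere \<open>|x| = r\<close> satisfies the required bound. Let
  \<open>m > 0\<close> be the minimum of \<open>|f|\<close> on this sphere. Each ray from the origin leaves \<open>f(cball 0 r)\<close> for the
  last time at a point \<open>f x\<close> with \<open>|x| = r\<close>, hence at distance at least \<open>m\<close>; since \<open>f\<close> is open and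
  discrete, the rest of the ray lifts to a curve from \<open>x\<close> that leaves every smaller ball about the origin
  before the ray reaches the unit sphere. So the image family of a ring contains a piece of each radial
  segment of the annulus \<open>m < |y| < 1\<close>, and Young's inequality along the rays bounds its modulus from
  below by \<open>\<omega> I powr (1 - p)\<close> with \<open>I = \<integral>\<^sub>m\<^sup>1 u powr (- (n - 1) / (p - 1)) du\<close>. Taking \<open>\<eta> = \<psi> / \<integral> \<psi>\<close> in the
  definition of a ring mapping bounds it from above by \<open>c J powr (\<alpha> - p)\<close>. Comparing the two is the claim.

  Integration along rays produces the constant \<open>n\<close> times the volume of the unit ball instead of the
  Hausdorff measure \<open>\<omega>\<close> of the sphere; only the inequality between the two is needed, and it
  follows from a Vitali covering of the sphere by small caps.
\<close>

section \<open>Lifting curves under open discrete maps\<close>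

text \<open>The lower bound sees \<open>f\<close> only through curves whose images are radial
  segments. On these the radius is the arc length, so admissibility turns into a one-dimensional
  extremal problem on each ray. Its extremal density is proportional to
  \<open>u powr (- (n - 1) / (p - 1))\<close>, which explains the integrand of \<open>I\<close>.
  With \<open>e = (n - p) / (p - 1)\<close> the value of \<open>I\<close> is
  \<open>(m powr (- e) - 1) / e\<close> for \<open>p < n\<close> and \<open>- ln m\<close> for
  \<open>p = n\<close>; solving for \<open>m\<close> produces the power in the first claim and the
  exponential in the second. A ring inside the ball has outer radius \<open>s < 1\<close>, while
  \<open>J\<close> is an integral up to 1. The lower bound depends on \<open>m\<close> but not on
  \<open>s\<close>, so \<open>s\<close> may tend to 1 after the comparison. If the minimum
  \<open>m\<close> is 0, the product in the claim vanishes at that point. The lower bound carries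
  the constant \<open>n * unit_ball_vol n\<close>, and replacing it by a smaller one preserves the
  estimate; this is why one inequality with \<omega> suffices.\<close>

lemma compact_locally_uniform:
  fixes P :: "'a::topological_space \<Rightarrow> real \<Rightarrow> bool"
  assumes "compact K"
    and loc: "\<And>x. x \<in> K \<Longrightarrow> \<exists>N d. open N \<and> x \<in> N \<and> 0 < d \<and> (\<forall>y\<in>N \<inter> K. P y d)"
    and mono: "\<And>y d d'. P y d \<Longrightarrow> 0 < d' \<Longrightarrow> d' \<le> d \<Longrightarrow> P y d'"
  shows "\<exists>d>0. \<forall>y\<in>K. P y d"
proof -
  obtain N d where N: "\<And>x. x \<in> K \<Longrightarrow> open (N x) \<and> x \<in> N x \<and> 0 < d x \<and> (\<forall>y\<in>N x \<inter> K. P y (d x))"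
    using loc by metis
  obtain D where D: "D \<subseteq> K" "finite D" "K \<subseteq> (\<Union>x\<in>D. N x)"
    by (rule compactE_image[OF \<open>compact K\<close>, of K N]) (use N in auto)
  \<comment> \<open>The inserted 1 gives a positive value also when \<open>K\<close>, and with it
    \<open>D\<close>, is empty.\<close>
  define m where "m = Min (insert 1 (d ` D))"
  have m: "0 < m" "\<And>x. x \<in> D \<Longrightarrow> m \<le> d x"
    using D N by (auto simp: m_def)
  have "P y m" if y: "y \<in> K" for y
  proof -
    obtain x where "x \<in> D" "y \<in> N x" using D y by blast
    then have "P y (d x)" using N D y by blast
    then show ?thesis using mono m \<open>x \<in> D\<close> by blast
  qed
  then show ?thesis using m by blast
qed

text \<open>Openness at \<open>x\<close> gives a radius \<open>d\<close> of attainable values around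
  \<open>f x\<close>. By continuity every nearby point can use \<open>d/2\<close> with the same
  preimages, and compactness makes the choice uniform.\<close>

lemma open_map_uniform_on_compact:
  fixes f :: "'a::metric_space \<Rightarrow> 'b::metric_space"
  assumes f: "open_map (top_of_set U) euclidean f" "continuous_on U f"
    and U: "open U" "compact K" "K \<subseteq> U" and "0 < e"
  obtains d where "0 < d" "\<And>x y. x \<in> K \<Longrightarrow> dist y (f x) < d \<Longrightarrow> \<exists>z\<in>U. dist z x < e \<and> f z = y"
proof -
  have "\<exists>d>0. \<forall>x\<in>K. \<forall>y. dist y (f x) < d \<longrightarrow> (\<exists>z\<in>U. dist z x < e \<and> f z = y)"
  proof (rule compact_locally_uniform[OF \<open>compact K\<close>])
    fix x assume x: "x \<in> K"
    have "openin (top_of_set U) (U \<inter> ball x (e/2))"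
      by (simp add: openin_open_Int)
    then have "open (f ` (U \<inter> ball x (e/2)))"
      using f(1) by (auto simp: open_map_def)
    moreover have "f x \<in> f ` (U \<inter> ball x (e/2))"
      using x U \<open>0 < e\<close> by auto
    ultimately obtain d where d: "0 < d" "ball (f x) d \<subseteq> f ` (U \<inter> ball x (e/2))"
      by (meson open_contains_ball)
    have "open (f -` ball (f x) (d/2) \<inter> U)"
      using continuous_open_preimage[OF f(2) U(1)] by (simp add: Int_commute)
    then have "open (f -` ball (f x) (d/2) \<inter> U \<inter> ball x (e/2))" by auto
    moreover have "x \<in> f -` ball (f x) (d/2) \<inter> U \<inter> ball x (e/2)"
      using x U d \<open>0 < e\<close> by auto
    moreover have "\<exists>z\<in>U. dist z x' < e \<and> f z = y"
      if "x' \<in> f -` ball (f x) (d/2) \<inter> U \<inter> ball x (e/2)" "dist y (f x') < d/2" for x' y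
    proof -
      have "dist (f x) (f x') < d/2" "dist x x' < e/2" using that(1) by auto
      then have "dist (f x) y < d"
        using that(2) dist_triangle_half_r[of "f x'" "f x" d y] by (simp add: dist_commute)
      then obtain z where z: "z \<in> U" "dist x z < e/2" "y = f z" using d(2) by auto
      then have "dist z x' < e"
        using \<open>dist x x' < e/2\<close> dist_triangle_half_r[of x z e x'] by simp
      with z show ?thesis by blast
    qed
    ultimately show "\<exists>N d. open N \<and> x \<in> N \<and> 0 < d \<and>
        (\<forall>x'\<in>N \<inter> K. \<forall>y. dist y (f x') < d \<longrightarrow> (\<exists>z\<in>U. dist z x' < e \<and> f z = y))"
      using d(1) by (metis (no_types, lifting) IntD1 half_gt_zero)
  qed force
  then show ?thesis using that by metis
qed

lemma discrete_subset:
  assumes "discrete (T :: 'a::metric_space set)" "S \<subseteq> T"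
  shows "discrete S"
  using assms unfolding discrete_def isolated_in_dist_Ex_iff by (meson subset_iff)

text \<open>A point \<open>x\<close> isolated in its fibre is surrounded by a shell that misses the
  fibre, so on this compact shell \<open>f\<close> keeps a positive distance from
  \<open>f x\<close>. A chain with steps shorter than the width of the shell can escape only by
  landing in it, and this is impossible while its image stays near \<open>f x\<close>.\<close>

lemma chain_in_fibre_small:
  fixes f :: "'a::metric_space \<Rightarrow> 'b::heine_borel"
  assumes K: "compact K" "continuous_on K f" and disc: "\<And>y. discrete {x \<in> K. f x = y}" and "0 < e"
  obtains d where "0 < d"
    "\<And>z N. \<lbrakk>\<And>i. i \<le> N \<Longrightarrow> z i \<in> K; \<And>i. i \<le> N \<Longrightarrow> dist (f (z i)) (f (z 0)) < d;
       \<And>i. i < N \<Longrightarrow> dist (z i) (z (Suc i)) < d\<rbrakk> \<Longrightarrow> dist (z 0) (z N) < e"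
proof -
  let ?P = "\<lambda>y d. \<forall>z N. z 0 = y \<and> (\<forall>i\<le>N. z i \<in> K) \<and> (\<forall>i\<le>N. dist (f (z i)) (f (z 0)) < d) \<and>
       (\<forall>i<N. dist (z i) (z (Suc i)) < d) \<longrightarrow> dist (z 0) (z N) < e"
  have "\<exists>d>0. \<forall>y\<in>K. ?P y d"
  proof (rule compact_locally_uniform[OF K(1)])
    fix x assume x: "x \<in> K"
    have "x isolated_in {z \<in> K. f z = f x}" using disc[of "f x"] x by (auto simp: discrete_def)
    then obtain r where r: "0 < r" "\<And>y. y \<in> K \<Longrightarrow> f y = f x \<Longrightarrow> dist x y < r \<Longrightarrow> y = x"
      unfolding isolated_in_dist_Ex_iff by blast
    \<comment> \<open>With the quarter, the shell of radii \<eta> to \<open>2 * \<eta>\<close> lies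
      within the isolating distance \<open>r\<close>, and two points of \<open>ball x \<eta>\<close>
      are less than \<open>e\<close> apart.\<close>
    define \<eta> where "\<eta> = min r e / 4"
    have \<eta>: "0 < \<eta>" "2 * \<eta> < r" "2 * \<eta> < e" using r \<open>0 < e\<close> by (auto simp: \<eta>_def min_def)
    define S where "S = K \<inter> {z. \<eta> \<le> dist x z} \<inter> {z. dist x z \<le> 2 * \<eta>}"
    have "closed {z. \<eta> \<le> dist x z}" "closed {z. dist x z \<le> 2 * \<eta>}"
      by (intro closed_Collect_le continuous_intros)+
    then have "compact S" unfolding S_def using K(1) by (simp add: compact_Int_closed)
    moreover have "continuous_on S f" using K(2) by (rule continuous_on_subset) (auto simp: S_def)
    ultimately have "closed (f ` S)" by (simp add: compact_continuous_image compact_imp_closed)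
    moreover have "f x \<notin> f ` S"
    proof
      assume "f x \<in> f ` S"
      then obtain z where "z \<in> S" "f z = f x" by auto
      then show False using r(2)[of z] \<eta> by (auto simp: S_def)
    qed
    ultimately obtain \<mu> where \<mu>: "0 < \<mu>" "\<And>z. z \<in> S \<Longrightarrow> \<mu> \<le> dist (f x) (f z)"
      using separate_point_closed[of "f ` S" "f x"] by blast
    obtain s where s: "0 < s" "\<And>y. y \<in> K \<Longrightarrow> dist y x < s \<Longrightarrow> dist (f y) (f x) < \<mu> / 2"
      using K(2) x \<mu>(1) unfolding continuous_on_iff by (metis half_gt_zero)
    have "?P y (min (\<mu>/2) \<eta>)" if y: "y \<in> ball x (min s \<eta>) \<inter> K" for y
    proof (intro allI impI, elim conjE)
      fix z N assume z: "z 0 = y" "\<forall>i\<le>N. z i \<in> K" "\<forall>i\<le>N. dist (f (z i)) (f (z 0)) < min (\<mu>/2) \<eta>"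
        "\<forall>i<N. dist (z i) (z (Suc i)) < min (\<mu>/2) \<eta>"
      have fy: "dist (f y) (f x) < \<mu>/2" using s(2)[of y] y by (simp add: dist_commute)
      have "dist x (z i) < \<eta>" if "i \<le> N" for i
        using that
      proof (induction i)
        case 0
        then show ?case using y z by simp
      next
        case (Suc i)
        then have i: "dist x (z i) < \<eta>" "dist (z i) (z (Suc i)) < \<eta>" using z(4) by auto
        then have "dist x (z (Suc i)) < 2 * \<eta>"
          using dist_triangle[of x "z (Suc i)" "z i"] by simp
        moreover have "dist (f x) (f (z (Suc i))) < \<mu>"
          using z(1,3) fy Suc.prems dist_triangle_half_r[of "f y" "f x" \<mu> "f (z (Suc i))"]
          by (simp add: dist_commute)
        ultimately show ?case
          using \<mu>(2)[of "z (Suc i)"] z(2) Suc.prems by (force simp: S_def)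
      qed
      from this[of 0] this[of N] have "dist (z 0) (z N) < 2 * \<eta>"
        using dist_triangle_less_add[of "z 0" x \<eta> "z N" \<eta>] by (simp add: dist_commute)
      then show "dist (z 0) (z N) < e" using \<eta> by simp
    qed
    moreover have "open (ball x (min s \<eta>))" "x \<in> ball x (min s \<eta>)" "0 < min (\<mu>/2) \<eta>"
      using s \<eta> \<mu> by auto
    ultimately show "\<exists>N d. open N \<and> x \<in> N \<and> 0 < d \<and> (\<forall>y\<in>N \<inter> K. ?P y d)"
      by (intro exI[of _ "ball x (min s \<eta>)"] exI[of _ "min (\<mu>/2) \<eta>"] conjI ballI) assumption+
  next
    fix y d d' assume "?P y d" "0 < d'" "d' \<le> (d::real)"
    then show "?P y d'"
    proof (intro allI impI)
      fix z N assume "z 0 = y \<and> (\<forall>i\<le>N. z i \<in> K) \<and> (\<forall>i\<le>N. dist (f (z i)) (f (z 0)) < d') \<and>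
        (\<forall>i<N. dist (z i) (z (Suc i)) < d')"
      then show "dist (z 0) (z N) < e"
        using \<open>?P y d\<close>[rule_format, of z N] \<open>d' \<le> d\<close> by fastforce
    qed
  qed
  then obtain d where d: "0 < d" "\<And>y. y \<in> K \<Longrightarrow> ?P y d" by metis
  show ?thesis
  proof (rule that[OF d(1)])
    fix z N assume "\<And>i. i \<le> N \<Longrightarrow> z i \<in> K" "\<And>i. i \<le> N \<Longrightarrow> dist (f (z i)) (f (z 0)) < d"
      "\<And>i. i < N \<Longrightarrow> dist (z i) (z (Suc i)) < d"
    then show "dist (z 0) (z N) < e" using d(2)[of "z 0"] by simp
  qed
qed

section \<open>Pointwise cluster points by Tychonoff's theorem\<close>

lemma compact_Pi_UNIV:
  fixes K :: "'b::topological_space set"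
  assumes "compact K"
  shows "compact {h :: 'a \<Rightarrow> 'b. \<forall>s. h s \<in> K}"
proof -
  have "compactin (product_topology (\<lambda>_::'a. euclidean) UNIV) (PiE UNIV (\<lambda>_. K))"
    unfolding compactin_PiE using assms by simp
  moreover have "PiE UNIV (\<lambda>_. K) = {h :: 'a \<Rightarrow> 'b. \<forall>s. h s \<in> K}" by auto
  ultimately show ?thesis by (simp add: euclidean_product_topology)
qed

text \<open>In an uncountable product a cluster point need not be the limit of a subsequence. The
  conclusion therefore speaks of finitely many arguments at a time, together with any property
  \<open>Q\<close> that holds eventually; this is all that an epsilon argument consumes.\<close>

lemma pointwise_cluster_point:
  fixes h :: "nat \<Rightarrow> 'a \<Rightarrow> 'b::metric_space"
  assumes "compact K" "\<And>k s. h k s \<in> K"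
  obtains g where "\<And>s. g s \<in> K"
    "\<And>Q S e. eventually Q sequentially \<Longrightarrow> finite S \<Longrightarrow> 0 < e \<Longrightarrow> \<exists>k. Q k \<and> (\<forall>s\<in>S. dist (h k s) (g s) < e)"
proof -
  let ?F = "filtermap h sequentially"
  have "?F \<noteq> bot" by (simp add: filtermap_bot_iff)
  moreover have "eventually (\<lambda>x. x \<in> {h. \<forall>s. h s \<in> K}) ?F"
    using assms(2) by (simp add: eventually_filtermap)
  ultimately obtain g where g: "\<forall>s. g s \<in> K" "inf (nhds g) ?F \<noteq> bot"
    using compact_Pi_UNIV[OF assms(1)] unfolding compact_filter by blast
  show ?thesis
  proof (rule that)
    show "g s \<in> K" for s using g by blast
    fix Q and S :: "'a set" and e :: real assume Q: "eventually Q sequentially" and S: "finite S" "0 < e"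
    have "open {x. \<forall>s\<in>S. x (id s) \<in> ball (g s) e}"
      by (rule product_topology_basis'[OF S(1)]) auto
    then have 1: "eventually (\<lambda>x. \<forall>s\<in>S. x s \<in> ball (g s) e) (nhds g)"
      unfolding eventually_nhds using S(2)
      by (intro exI[of _ "{x. \<forall>s\<in>S. x (id s) \<in> ball (g s) e}"]) auto
    show "\<exists>k. Q k \<and> (\<forall>s\<in>S. dist (h k s) (g s) < e)"
    proof (rule ccontr)
      assume *: "\<not> ?thesis"
      have "eventually (\<lambda>x. \<not> (\<forall>s\<in>S. x s \<in> ball (g s) e)) ?F"
        unfolding eventually_filtermap using Q
        by eventually_elim (use * in \<open>auto simp: dist_commute\<close>)
      with 1 have "eventually (\<lambda>_. False) (inf (nhds g) ?F)"
        unfolding eventually_inf by blast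
      with g(2) show False by (simp add: eventually_False)
    qed
  qed
qed

text \<open>The lift is a step function whose jumps are smaller than \<open>e\<close>; it is frozen at time \<open>\<tau>\<close>, when it
  comes within \<open>e\<close> of the complement of \<open>V\<close>. Consecutive values form the chain in the conclusion.\<close>

lemma open_map_approximate_lift:
  fixes f :: "'a::metric_space \<Rightarrow> 'b::metric_space" and \<beta> :: "real \<Rightarrow> 'b"
  assumes f: "open_map (top_of_set U) euclidean f" "continuous_on U f" "open U"
    and V: "compact (closure V)" "closure V \<subseteq> U"
    and \<beta>: "a < b" "continuous_on {a..b} \<beta>"
    and x: "x \<in> V" "f x = \<beta> a" and "0 < e"
  obtains h \<tau> where "\<tau> \<in> {a..b}" "h a = x"
    "\<And>s. \<tau> \<le> s \<Longrightarrow> s \<le> b \<Longrightarrow> h s = h b"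
    "\<tau> = b \<or> (\<exists>y. y \<notin> V \<and> dist (h b) y < e)"
    "\<And>s s'. a \<le> s \<Longrightarrow> s \<le> s' \<Longrightarrow> s' \<le> b \<Longrightarrow> \<exists>z N. z 0 = h s \<and> z N = h s' \<and>
       (\<forall>i\<le>N. z i \<in> closure V) \<and> (\<forall>i\<le>N. \<exists>u. a \<le> u \<and> s - e \<le> u \<and> u \<le> s' \<and> f (z i) = \<beta> (min u \<tau>)) \<and>
       (\<forall>i<N. dist (z i) (z (Suc i)) < e)"
proof -
  obtain \<delta> where \<delta>: "0 < \<delta>"
    "\<And>x y. x \<in> closure V \<Longrightarrow> dist y (f x) < \<delta> \<Longrightarrow> \<exists>z\<in>U. dist z x < e \<and> f z = y"
    using open_map_uniform_on_compact[OF f(1,2,3) V \<open>0 < e\<close>] by metis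
  have "uniformly_continuous_on {a..b} \<beta>"
    using \<beta>(2) compact_uniformly_continuous by blast
  then obtain \<mu> where \<mu>: "0 < \<mu>"
    "\<And>u v. u \<in> {a..b} \<Longrightarrow> v \<in> {a..b} \<Longrightarrow> dist u v < \<mu> \<Longrightarrow> dist (\<beta> u) (\<beta> v) < \<delta>"
    unfolding uniformly_continuous_on_def using \<delta>(1) by (metis dist_commute)
  obtain M :: nat where M: "0 < M" "(b - a) / min \<mu> e < real M"
    using reals_Archimedean2[of "max 0 ((b - a) / min \<mu> e)"]
    by (metis max_less_iff_conj of_nat_0_less_iff)
  define d where "d = (b - a) / real M"
  have Md: "real M * d = b - a" using M by (simp add: d_def)
  have d: "0 < d" "d < \<mu>" "d < e"
  proof -
    have "b - a < real M * min \<mu> e" using M(2) \<open>0 < e\<close> \<mu>(1) by (simp add: divide_less_eq)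
    then have "d < min \<mu> e" using M(1) pos_divide_less_eq[of "real M" "b - a" "min \<mu> e"]
      by (simp add: d_def mult.commute del: min_less_iff_conj)
    then show "0 < d" "d < \<mu>" "d < e" using \<beta>(1) M(1) by (auto simp: d_def)
  qed
  define t where "t i = a + real i * d" for i
  have t: "t 0 = a" "t M = b" "\<And>i. t (Suc i) = t i + d" "\<And>i j. i \<le> j \<Longrightarrow> t i \<le> t j"
    using Md d(1) by (auto simp: t_def algebra_simps intro!: mult_right_mono)
  have tab: "t i \<in> {a..b}" if "i \<le> M" for i using t(4)[of 0 i] t(4)[of i M] that t(1,2) by simp
  define ok where "ok i x x' \<longleftrightarrow> x' \<in> closure V \<and> dist x x' < e \<and> f x' = \<beta> (t (Suc i))" for i x x'
  define y where "y = rec_nat x (\<lambda>i x. SOME x'. ok i x x')"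
  have y0: "y 0 = x" and ySuc: "\<And>i. y (Suc i) = (SOME x'. ok i (y i) x')" by (simp_all add: y_def)
  \<comment> \<open>The first index at which no next value exists within \<open>closure V\<close>,
    or \<open>M\<close> if there is none; the lift is frozen from there on.\<close>
  define N where "N = (LEAST i. i \<ge> M \<or> \<not> (\<exists>x'. ok i (y i) x'))"
  have NM: "N \<le> M" unfolding N_def by (rule Least_le) simp
  have N: "N = M \<or> \<not> (\<exists>x'. ok N (y N) x')"
    using LeastI[of "\<lambda>i. i \<ge> M \<or> \<not> (\<exists>x'. ok i (y i) x')" M] NM unfolding N_def[symmetric] by auto
  have step: "ok i (y i) (y (Suc i))" if "i < N" for i
  proof -
    have "\<exists>x'. ok i (y i) x'" using not_less_Least[of i] that unfolding N_def by blast
    then show ?thesis unfolding ySuc by (rule someI_ex)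
  qed
  have y: "y i \<in> closure V \<and> f (y i) = \<beta> (t i)" if "i \<le> N" for i
    using that
  proof (cases i)
    case 0
    then show ?thesis using x y0 t closure_subset[of V] by auto
  next
    case (Suc j)
    then show ?thesis using step[of j] that by (simp add: ok_def)
  qed
  define X where "X i = y (min i N)" for i
  have X: "X i \<in> closure V" "f (X i) = \<beta> (min (t i) (t N))" "dist (X i) (X (Suc i)) < e" for i
  proof -
    show "X i \<in> closure V" using y[of "min i N"] by (simp add: X_def)
    have "t (min i N) = min (t i) (t N)" using t(4)[of i N] t(4)[of N i] by (auto simp: min_def)
    then show "f (X i) = \<beta> (min (t i) (t N))" using y[of "min i N"] by (simp add: X_def)
    show "dist (X i) (X (Suc i)) < e"
    proof (cases "i < N")
      case True
      then show ?thesis using step[of i] by (simp add: X_def ok_def Suc_leI min_absorb1)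
    next
      case False
      then show ?thesis using \<open>0 < e\<close> by (simp add: X_def min_absorb2)
    qed
  qed
  define ix where "ix s = nat \<lfloor>(s - a) / d\<rfloor>" for s
  have ix: "t (ix s) \<le> s" "s < t (ix s) + d" if "a \<le> s" for s
  proof -
    have "real (ix s) \<le> (s - a) / d" "(s - a) / d < real (ix s) + 1"
      using that d(1) by (auto simp: ix_def)
    then show "t (ix s) \<le> s" "s < t (ix s) + d" using d(1) by (auto simp: t_def field_simps)
  qed
  have ix_mono: "ix s \<le> ix s'" if "s \<le> s'" for s s'
    using that d(1) by (auto simp: ix_def intro!: nat_mono floor_mono divide_right_mono)
  have ix_t: "ix (t i) = i" for i using d(1) by (simp add: ix_def t_def)
  define h where "h s = X (ix s)" for s
  have frozen: "h s = y N" if "t N \<le> s" for s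
    using ix_mono[OF that] by (simp add: h_def X_def ix_t min_absorb2)
  show ?thesis
  proof (rule that[of "t N" h])
    show "t N \<in> {a..b}" using tab NM by blast
    show "h a = x" using ix_t[of 0] by (simp add: h_def X_def t y0)
    show "h s = h b" if "t N \<le> s" "s \<le> b" for s
      using that frozen[of s] frozen[of b] by simp
    show "t N = b \<or> (\<exists>y. y \<notin> V \<and> dist (h b) y < e)"
    proof (cases "N = M")
      case False
      \<comment> \<open>Openness does supply a preimage \<open>z\<close> of the next value near
        \<open>y N\<close>. As the step failed nevertheless, \<open>z\<close> lies outside
        \<open>closure V\<close>.\<close>
      have "dist (t (Suc N)) (t N) < \<mu>" using d t(3) by (simp add: dist_real_def)
      moreover have "t (Suc N) \<in> {a..b}" "t N \<in> {a..b}" using tab NM False by auto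
      ultimately have "dist (\<beta> (t (Suc N))) (f (y N)) < \<delta>" using \<mu>(2) y by simp
      then obtain z where z: "z \<in> U" "dist z (y N) < e" "f z = \<beta> (t (Suc N))"
        using \<delta>(2)[of "y N"] y by blast
      then have "z \<notin> closure V" using N False unfolding ok_def by (metis dist_commute)
      then have "z \<notin> V" using closure_subset by blast
      moreover have "h b = y N" using frozen[of b] tab NM by simp
      ultimately show ?thesis using z by (metis dist_commute)
    qed (simp add: t)
    show "\<exists>z N'. z 0 = h s \<and> z N' = h s' \<and>
       (\<forall>i\<le>N'. z i \<in> closure V) \<and> (\<forall>i\<le>N'. \<exists>u. a \<le> u \<and> s - e \<le> u \<and> u \<le> s' \<and> f (z i) = \<beta> (min u (t N))) \<and>
       (\<forall>i<N'. dist (z i) (z (Suc i)) < e)" if "a \<le> s" "s \<le> s'" "s' \<le> b" for s s'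
    proof (intro exI[of _ "\<lambda>k. X (ix s + k)"] exI[of _ "ix s' - ix s"] conjI allI impI)
      fix i assume "i \<le> ix s' - ix s"
      then have i: "ix s + i \<le> ix s'" using ix_mono[of s s'] that by linarith
      \<comment> \<open>The value \<open>h s\<close> belongs to the last grid point at or before
        \<open>s\<close>, which is less than \<open>d < e\<close> earlier; hence the lower bound
        \<open>s - e\<close>.\<close>
      show "\<exists>u. a \<le> u \<and> s - e \<le> u \<and> u \<le> s' \<and> f (X (ix s + i)) = \<beta> (min u (t N))"
        using t(4)[of 0 "ix s"] t(4)[of "ix s" "ix s + i"] t(4)[OF i] ix[of s] ix[of s'] that d X(2)
        by (intro exI[of _ "t (ix s + i)"]) (auto simp: t(1))
    qed (use X ix_mono[OF that(2)] in \<open>auto simp: h_def\<close>)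
  qed
qed

text \<open>Approximate lifts have a common modulus of continuity because a chain of small steps whose image stays
  near one point cannot leave a neighbourhood of a point of the discrete fibre. Hence a pointwise
  cluster point of approximate lifts is continuous.\<close>

lemma open_discrete_lift:
  fixes f :: "'a::metric_space \<Rightarrow> 'b::heine_borel" and \<beta> :: "real \<Rightarrow> 'b"
  assumes f: "open_map (top_of_set U) euclidean f" "continuous_on U f" "\<And>y. discrete {x \<in> U. f x = y}"
    and U: "open U" and V: "open V" "compact (closure V)" "closure V \<subseteq> U"
    and \<beta>: "a < b" "continuous_on {a..b} \<beta>" "\<beta> b \<notin> f ` closure V"
    and x: "x \<in> V" "f x = \<beta> a"
  obtains g \<sigma> where "a < \<sigma>" "\<sigma> < b" "continuous_on {a..\<sigma>} g" "g a = x"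
    "\<And>s. s \<in> {a..\<sigma>} \<Longrightarrow> f (g s) = \<beta> s" "\<And>s. s \<in> {a..<\<sigma>} \<Longrightarrow> g s \<in> V" "g \<sigma> \<in> frontier V"
proof -
  define K where "K = closure V"
  have K: "compact K" "K \<subseteq> U" "continuous_on K f" "V \<subseteq> K"
    using V continuous_on_subset[OF f(2) V(3)] closure_subset[of V] by (simp_all add: K_def)
  have discK: "discrete {x \<in> K. f x = y}" for y
    by (rule discrete_subset[OF f(3)[of y]]) (use K(2) in auto)
  let ?e = "\<lambda>k. 1 / real (Suc k)"
  define P where "P k h \<tau> \<longleftrightarrow> \<tau> \<in> {a..b} \<and> h a = x \<and> (\<forall>s. \<tau> \<le> s \<longrightarrow> s \<le> b \<longrightarrow> h s = h b) \<and>
    (\<tau> = b \<or> (\<exists>y. y \<notin> V \<and> dist (h b) y < ?e k)) \<and>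
    (\<forall>s s'. a \<le> s \<longrightarrow> s \<le> s' \<longrightarrow> s' \<le> b \<longrightarrow> (\<exists>z N. z 0 = h s \<and> z N = h s' \<and>
       (\<forall>i\<le>N. z i \<in> K) \<and> (\<forall>i\<le>N. \<exists>u. a \<le> u \<and> s - ?e k \<le> u \<and> u \<le> s' \<and> f (z i) = \<beta> (min u \<tau>)) \<and>
       (\<forall>i<N. dist (z i) (z (Suc i)) < ?e k)))" for k h \<tau>
  have "\<exists>h \<tau>. P k h \<tau>" for k
  proof (rule open_map_approximate_lift[OF f(1,2) U V(2,3) \<beta>(1,2) x, of "?e k"])
    fix h \<tau> assume a: "\<tau> \<in> {a..b}" "h a = x" "\<And>s. \<tau> \<le> s \<Longrightarrow> s \<le> b \<Longrightarrow> h s = h b"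
      "\<tau> = b \<or> (\<exists>y. y \<notin> V \<and> dist (h b) y < ?e k)"
      "\<And>s s'. a \<le> s \<Longrightarrow> s \<le> s' \<Longrightarrow> s' \<le> b \<Longrightarrow> \<exists>z N. z 0 = h s \<and> z N = h s' \<and>
       (\<forall>i\<le>N. z i \<in> closure V) \<and> (\<forall>i\<le>N. \<exists>u. a \<le> u \<and> s - ?e k \<le> u \<and> u \<le> s' \<and> f (z i) = \<beta> (min u \<tau>)) \<and>
       (\<forall>i<N. dist (z i) (z (Suc i)) < ?e k)"
    have "P k h \<tau>" unfolding P_def K_def
      by (intro conjI allI impI) (fact a(1) a(2) a(4) | erule (1) a(3) | erule (2) a(5))+
    then show ?thesis by blast
  qed simp
  then obtain H T where HT: "\<And>k. P k (H k) (T k)" by metis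
  have Tab: "\<And>k. T k \<in> {a..b}" and Ha: "\<And>k. H k a = x"
    and Hfr: "\<And>k s. T k \<le> s \<Longrightarrow> s \<le> b \<Longrightarrow> H k s = H k b"
    and Hend: "\<And>k. T k = b \<or> (\<exists>y. y \<notin> V \<and> dist (H k b) y < ?e k)"
    using HT unfolding P_def by blast+
  have Hch: "\<exists>z N. z 0 = H k s \<and> z N = H k s' \<and> (\<forall>i\<le>N. z i \<in> K) \<and>
       (\<forall>i\<le>N. \<exists>u. a \<le> u \<and> s - ?e k \<le> u \<and> u \<le> s' \<and> f (z i) = \<beta> (min u (T k))) \<and>
       (\<forall>i<N. dist (z i) (z (Suc i)) < ?e k)" if "a \<le> s" "s \<le> s'" "s' \<le> b" for k s s'
    using HT[of k] that unfolding P_def by blast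
  have H1: "H k s \<in> K \<and> (\<exists>u. a \<le> u \<and> s - ?e k \<le> u \<and> u \<le> s \<and> f (H k s) = \<beta> (min u (T k)))"
    if "s \<in> {a..b}" for k s
    using Hch[of s s k] that by (metis atLeastAtMost_iff le0 order_refl)
  \<comment> \<open>Only the stopping times are made to converge along a subsequence; for the lifts
    themselves a cluster point is enough.\<close>
  obtain \<tau> r where \<tau>: "\<tau> \<in> {a..b}" and r: "strict_mono r" and lim: "(T \<circ> r) \<longlonglongrightarrow> \<tau>"
    using compact_Icc[of a b] Tab unfolding compact_def by metis
  have Tlim: "\<forall>\<^sub>F k in sequentially. \<bar>T (r k) - \<tau>\<bar> < e" if "0 < e" for e
    using tendstoD[OF lim that] by (simp add: dist_real_def)
  have elim0: "\<forall>\<^sub>F k in sequentially. ?e (r k) < e" if "0 < e" for e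
  proof -
    have "\<forall>\<^sub>F k in sequentially. ?e k < e"
      using order_tendstoD(2)[OF LIMSEQ_inverse_real_of_nat that] by (simp add: inverse_eq_divide)
    then show ?thesis by (rule eventually_subseq[OF r])
  qed
  \<comment> \<open>Outside \<open>{a..b}\<close> the value at \<open>a\<close> is repeated, since
    the cluster point lemma wants all values in \<open>K\<close>.\<close>
  define h where "h k s = H (r k) (if s \<in> {a..b} then s else a)" for k s
  have "h k s \<in> K" for k s using H1 \<beta>(1) by (simp add: h_def)
  then obtain g where gK: "\<And>s. g s \<in> K" and
    clus: "\<And>Q S e. eventually Q sequentially \<Longrightarrow> finite S \<Longrightarrow> 0 < e \<Longrightarrow> \<exists>k. Q k \<and> (\<forall>s\<in>S. dist (h k s) (g s) < e)"
    using pointwise_cluster_point[OF K(1), of h] by metis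
  have h: "h k s = H (r k) s" if "s \<in> {a..b}" for k s using that by (simp add: h_def)
  have "uniformly_continuous_on {a..b} \<beta>"
    using \<beta>(2) compact_uniformly_continuous by blast
  then have uc: "\<exists>\<mu>>0. \<forall>u\<in>{a..b}. \<forall>v\<in>{a..b}. \<bar>u - v\<bar> < \<mu> \<longrightarrow> dist (\<beta> u) (\<beta> v) < e" if "0 < e" for e
    using that unfolding uniformly_continuous_on_def dist_real_def by (metis abs_minus_commute dist_commute)
  have modulus: "\<exists>\<delta>>0. \<forall>s s'. a \<le> s \<longrightarrow> s \<le> s' \<longrightarrow> s' \<le> b \<longrightarrow> s' - s < \<delta> \<longrightarrow> dist (g s) (g s') < e" if e0: "0 < e" for e
  proof -
    obtain d where d: "0 < d"
      "\<And>z N. \<lbrakk>\<And>i. i \<le> N \<Longrightarrow> z i \<in> K; \<And>i. i \<le> N \<Longrightarrow> dist (f (z i)) (f (z 0)) < d;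
         \<And>i. i < N \<Longrightarrow> dist (z i) (z (Suc i)) < d\<rbrakk> \<Longrightarrow> dist (z 0) (z N) < e/3"
      by (rule chain_in_fibre_small[OF K(1,3) discK, of "e/3"]) (use e0 in auto)
    obtain \<mu> where \<mu>: "0 < \<mu>" "\<forall>u\<in>{a..b}. \<forall>v\<in>{a..b}. \<bar>u - v\<bar> < \<mu> \<longrightarrow> dist (\<beta> u) (\<beta> v) < d"
      using uc[OF d(1)] by blast
    have "dist (g s) (g s') < e" if s: "a \<le> s" "s \<le> s'" "s' \<le> b" "s' - s < \<mu>/2" for s s'
    proof -
      have Q: "\<forall>\<^sub>F k in sequentially. ?e (r k) < min d (\<mu>/2)" by (rule elim0) (use \<mu> d in simp)
      obtain k where k: "?e (r k) < min d (\<mu>/2)" "\<forall>u\<in>{s,s'}. dist (h k u) (g u) < e/3"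
        using clus[OF Q, of "{s,s'}" "e/3"] \<open>0 < e\<close> by auto
      obtain z N where z: "z 0 = H (r k) s" "z N = H (r k) s'" "\<forall>i\<le>N. z i \<in> K"
        "\<forall>i\<le>N. \<exists>u. a \<le> u \<and> s - ?e (r k) \<le> u \<and> u \<le> s' \<and> f (z i) = \<beta> (min u (T (r k)))"
        "\<forall>i<N. dist (z i) (z (Suc i)) < ?e (r k)"
        using Hch[OF s(1-3), of "r k"] by blast
      have "dist (z 0) (z N) < e/3"
      proof (rule d(2))
        fix i assume "i \<le> N"
        then obtain u where u: "a \<le> u" "s - ?e (r k) \<le> u" "u \<le> s'" "f (z i) = \<beta> (min u (T (r k)))"
          using z(4) by blast
        obtain v where v: "a \<le> v" "s - ?e (r k) \<le> v" "v \<le> s'" "f (z 0) = \<beta> (min v (T (r k)))"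
          using z(4) by blast
        \<comment> \<open>Both parameters lie in an interval of length less than \<mu>, and cutting
          off at the stopping time does not increase their distance.\<close>
        have "\<bar>min u (T (r k)) - min v (T (r k))\<bar> < \<mu>" using u(2,3) v(2,3) s(4) k(1) by linarith
        moreover have "min u (T (r k)) \<in> {a..b}" "min v (T (r k)) \<in> {a..b}" using u v Tab[of "r k"] by auto
        ultimately show "dist (f (z i)) (f (z 0)) < d" using \<mu>(2) u(4) v(4) by simp
      qed (use z k in force)+
      then have "dist (h k s) (h k s') < e/3" using s z by (simp add: h)
      moreover have "dist (h k s) (g s) < e/3" "dist (h k s') (g s') < e/3" using k(2) by auto
      ultimately show ?thesis
        using dist_triangle[of "g s" "g s'" "h k s"] dist_triangle[of "h k s" "g s'" "h k s'"]
        by (simp add: dist_commute)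
    qed
    then show ?thesis using \<mu>(1) half_gt_zero by blast
  qed
  have contg: "continuous_on {a..b} g"
    unfolding continuous_on_iff
  proof (intro ballI allI impI)
    fix s and e :: real assume "s \<in> {a..b}" "0 < e"
    then obtain \<delta> where \<delta>: "0 < \<delta>"
      "\<And>s s'. a \<le> s \<Longrightarrow> s \<le> s' \<Longrightarrow> s' \<le> b \<Longrightarrow> s' - s < \<delta> \<Longrightarrow> dist (g s) (g s') < e"
      using modulus by blast
    have "dist (g s') (g s) < e" if "s' \<in> {a..b}" "dist s' s < \<delta>" for s'
      using \<delta>(2)[of s s'] \<delta>(2)[of s' s] that \<open>s \<in> {a..b}\<close>
      by (cases "s \<le> s'") (auto simp: dist_real_def dist_commute abs_less_iff)
    then show "\<exists>d>0. \<forall>s'\<in>{a..b}. dist s' s < d \<longrightarrow> dist (g s') (g s) < e"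
      using \<delta>(1) by blast
  qed
  have fg: "f (g s) = \<beta> (min s \<tau>)" if s: "s \<in> {a..b}" for s
  proof (rule ccontr)
    define e where "e = dist (f (g s)) (\<beta> (min s \<tau>)) / 2"
    assume "f (g s) \<noteq> \<beta> (min s \<tau>)"
    then have e: "0 < e" by (simp add: e_def)
    obtain \<eta> where \<eta>: "0 < \<eta>" "\<forall>y\<in>K. dist y (g s) < \<eta> \<longrightarrow> dist (f y) (f (g s)) < e"
      using K(3) gK e unfolding continuous_on_iff by blast
    obtain \<mu> where \<mu>: "0 < \<mu>" "\<forall>u\<in>{a..b}. \<forall>v\<in>{a..b}. \<bar>u - v\<bar> < \<mu> \<longrightarrow> dist (\<beta> u) (\<beta> v) < e"
      using uc[OF e] by blast
    have Q: "\<forall>\<^sub>F k in sequentially. ?e (r k) < \<mu>/2 \<and> \<bar>T (r k) - \<tau>\<bar> < \<mu>/2"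
      by (intro eventually_conj elim0 Tlim) (use \<mu> in auto)
    obtain k where k: "?e (r k) < \<mu>/2" "\<bar>T (r k) - \<tau>\<bar> < \<mu>/2" "dist (h k s) (g s) < \<eta>"
      using clus[OF Q, of "{s}" \<eta>] \<eta>(1) by auto
    obtain u where u: "a \<le> u" "s - ?e (r k) \<le> u" "u \<le> s" "f (H (r k) s) = \<beta> (min u (T (r k)))"
      and HK: "H (r k) s \<in> K"
      using H1[OF s] by blast
    have "\<bar>min u (T (r k)) - min s \<tau>\<bar> < \<mu>" using u(2,3) k by linarith
    moreover have "min u (T (r k)) \<in> {a..b}" "min s \<tau> \<in> {a..b}" using u s \<tau> Tab[of "r k"] by auto
    ultimately have "dist (f (H (r k) s)) (\<beta> (min s \<tau>)) < e" using \<mu>(2) u(4) by simp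
    moreover have "dist (f (H (r k) s)) (f (g s)) < e" using \<eta>(2) HK k(3) s by (simp add: h)
    ultimately show False
      using dist_triangle[of "f (g s)" "\<beta> (min s \<tau>)" "f (H (r k) s)"] by (simp add: e_def dist_commute)
  qed
  \<comment> \<open>Otherwise \<open>g b\<close>, a point of \<open>closure V\<close>, would be a
    preimage of \<open>\<beta> b\<close>.\<close>
  have "\<tau> \<noteq> b" using fg[of b] \<beta>(1,3) gK[of b] unfolding K_def by (metis atLeastAtMost_iff image_eqI less_imp_le min.idem order_refl)
  then have \<tau>b: "\<tau> < b" using \<tau> by simp
  have frozen: "g s = g b" if "\<tau> < s" "s \<le> b" for s
  proof (rule ccontr)
    define e where "e = dist (g s) (g b) / 2"
    assume "g s \<noteq> g b"
    then have e: "0 < e" by (simp add: e_def)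
    have Q: "\<forall>\<^sub>F k in sequentially. \<bar>T (r k) - \<tau>\<bar> < s - \<tau>" using Tlim that by simp
    obtain k where k: "\<bar>T (r k) - \<tau>\<bar> < s - \<tau>" "\<forall>u\<in>{s,b}. dist (h k u) (g u) < e"
      using clus[OF Q, of "{s,b}" e] e by auto
    have "h k s = h k b" using Hfr[of "r k" s] k(1) that \<tau> \<beta>(1) by (simp add: h)
    then show False using k(2) dist_triangle2[of "g s" "g b" "h k b"] by (simp add: e_def dist_commute)
  qed
  have gb: "g b \<notin> V"
  proof
    assume "g b \<in> V"
    then obtain e where e: "0 < e" "ball (g b) e \<subseteq> V" using V(1) open_contains_ball by blast
    have Q: "\<forall>\<^sub>F k in sequentially. ?e (r k) < e/2 \<and> \<bar>T (r k) - \<tau>\<bar> < b - \<tau>"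
      by (intro eventually_conj elim0 Tlim) (use \<tau>b e in auto)
    obtain k where k: "?e (r k) < e/2" "\<bar>T (r k) - \<tau>\<bar> < b - \<tau>" "dist (h k b) (g b) < e/2"
      using clus[OF Q, of "{b}" "e/2"] e(1) by auto
    then obtain y where "y \<notin> V" "dist (H (r k) b) y < e/2" using Hend[of "r k"] by auto
    then have "dist (g b) y < e" using k(3) \<beta>(1) dist_triangle_half_r[of "h k b" "g b" e y] by (simp add: h)
    with e \<open>y \<notin> V\<close> show False by auto
  qed
  have g\<tau>: "g \<tau> = g b"
  proof (rule ccontr)
    assume "g \<tau> \<noteq> g b"
    then obtain \<delta> where "0 < \<delta>" "\<forall>s s'. a \<le> s \<longrightarrow> s \<le> s' \<longrightarrow> s' \<le> b \<longrightarrow> s' - s < \<delta> \<longrightarrow> dist (g s) (g s') < dist (g \<tau>) (g b)"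
      using modulus[of "dist (g \<tau>) (g b)"] by auto
    then have "dist (g \<tau>) (g (min b (\<tau> + \<delta>/2))) < dist (g \<tau>) (g b)" using \<tau> \<tau>b by auto
    then show False using frozen[of "min b (\<tau> + \<delta>/2)"] \<open>0 < \<delta>\<close> \<tau>b by auto
  qed
  have ga: "g a = x"
  proof (rule ccontr)
    assume "g a \<noteq> x"
    then obtain k where "dist (h k a) (g a) < dist x (g a)"
      using clus[of "\<lambda>_. True" "{a}" "dist x (g a)"] by auto
    then show False using Ha \<beta>(1) by (simp add: h)
  qed
  \<comment> \<open>The limit may meet the complement of \<open>V\<close> before \<tau>, so the
    curve is cut at its first exit time \<sigma> instead.\<close>
  define S where "S = {a..b} \<inter> g -` (- V)"
  have "closed S" unfolding S_def
    by (rule continuous_closed_preimage[OF contg]) (use V(1) in \<open>auto simp: closed_def\<close>)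
  then have "compact S" by (simp add: S_def bounded_Int compact_eq_bounded_closed)
  moreover have \<tau>S: "\<tau> \<in> S" using \<tau> gb g\<tau> by (simp add: S_def)
  ultimately obtain \<sigma> where \<sigma>: "\<sigma> \<in> S" "\<And>s. s \<in> S \<Longrightarrow> \<sigma> \<le> s"
    using compact_attains_inf by (metis empty_iff)
  have \<sigma>\<tau>: "\<sigma> \<le> \<tau>" using \<sigma> \<tau>S by blast
  show ?thesis
  proof (rule that[of \<sigma> g])
    have "\<sigma> \<noteq> a" using ga x(1) \<sigma>(1) by (auto simp: S_def)
    then show "a < \<sigma>" using \<sigma>(1) by (simp add: S_def)
    show "\<sigma> < b" using \<sigma>\<tau> \<tau>b by simp
    show "continuous_on {a..\<sigma>} g" using contg by (rule continuous_on_subset) (use \<sigma>\<tau> \<tau>b in auto)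
    show "g a = x" by fact
    show "f (g s) = \<beta> s" if "s \<in> {a..\<sigma>}" for s using fg[of s] that \<sigma>\<tau> \<tau>b by simp
    show "g s \<in> V" if "s \<in> {a..<\<sigma>}" for s
      using \<sigma>(2)[of s] that \<sigma>\<tau> \<tau>b by (force simp: S_def)
    show "g \<sigma> \<in> frontier V"
      using gK[of \<sigma>] \<sigma>(1) V(1) by (simp add: frontier_def K_def S_def interior_open)
  qed
qed


section \<open>An upper bound for the Hausdorff measure of the sphere\<close>

text \<open>For a unit vector \<open>x\<close> this is the sector of the unit ball over the
  spherical cap of chordal radius \<open>s\<close>. Its volume is the area of the cap divided by the
  dimension, so areas of caps can be estimated by Lebesgue measure.\<close>

definition cap_cone :: "'a::euclidean_space \<Rightarrow> real \<Rightarrow> 'a set" where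
  "cap_cone x s = {y. y \<noteq> 0 \<and> norm y < 1 \<and> dist (y /\<^sub>R norm y) x < s}"

lemma open_cap_cone: "open (cap_cone x s)"
proof -
  have "continuous_on (- {0}) (\<lambda>y. dist (y /\<^sub>R norm y) x)"
    by (intro continuous_intros) auto
  then have "open (- {0} \<inter> (\<lambda>y. dist (y /\<^sub>R norm y) x) -` {..<s})"
    by (intro continuous_open_preimage) auto
  moreover have "cap_cone x s = (- {0} \<inter> (\<lambda>y. dist (y /\<^sub>R norm y) x) -` {..<s}) \<inter> ball 0 1"
    by (auto simp: cap_cone_def)
  ultimately show ?thesis by auto
qed

text \<open>The height \<open>1 / sqrt (1 + s^2)\<close> puts the rim of the straight cone of slope
  \<open>s\<close> on the unit sphere. Its half-angle has cosine \<open>1 / sqrt (1 + s^2)\<close>,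
  which exceeds \<open>1 - s^2 / 2\<close>, the cosine of the angle with chord
  \<open>s\<close>.\<close>

lemma coordinate_cone_subset_cap_cone:
  fixes e :: "'a::euclidean_space"
  assumes e: "e \<in> Basis" and y: "0 < y \<bullet> e" "y \<bullet> e < 1 / sqrt (1 + s\<^sup>2)"
    and le: "sqrt (\<Sum>i\<in>Basis - {e}. (y \<bullet> i)\<^sup>2) \<le> y \<bullet> e * s" and s: "0 < s"
  shows "y \<in> cap_cone e s"
proof -
  define q where "q = (\<Sum>i\<in>Basis - {e}. (y \<bullet> i)\<^sup>2)"
  have q: "0 \<le> q" "q \<le> (y \<bullet> e * s)\<^sup>2"
    using le real_sqrt_le_iff'[of q "y \<bullet> e * s"] y s by (auto simp: q_def sum_nonneg)
  have n2: "(norm y)\<^sup>2 = (y \<bullet> e)\<^sup>2 + q"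
    unfolding q_def power2_norm_eq_inner euclidean_inner[of y y]
    using e by (simp add: sum.remove power2_eq_square)
  have y0: "y \<noteq> 0" using y by auto
  have le2: "(norm y)\<^sup>2 \<le> (y \<bullet> e)\<^sup>2 * (1 + s\<^sup>2)"
    using q by (simp add: n2 algebra_simps power_mult_distrib)
  have "(y \<bullet> e)\<^sup>2 < (1 / sqrt (1 + s\<^sup>2))\<^sup>2" using y by (intro power_strict_mono) auto
  moreover have "0 < 1 + s\<^sup>2" by (simp add: add_pos_nonneg)
  ultimately have "(y \<bullet> e)\<^sup>2 * (1 + s\<^sup>2) < 1" by (simp add: power_divide pos_less_divide_eq)
  then have "norm y < 1" using le2 abs_square_less_1[of "norm y"] by simp
  moreover have "dist (y /\<^sub>R norm y) e < s"
  proof -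
    have "norm y \<le> (y \<bullet> e) * sqrt (1 + s\<^sup>2)"
      using real_sqrt_le_mono[OF le2] y by (simp add: real_sqrt_mult)
    also have "sqrt (1 + s\<^sup>2) < 1 + s\<^sup>2 / 2"
      by (rule real_less_lsqrt) (use s in \<open>auto simp: power2_eq_square algebra_simps add_pos_nonneg\<close>)
    finally have *: "norm y < (y \<bullet> e) * (1 + s\<^sup>2 / 2)" using y by simp
    \<comment> \<open>The product \<open>(1 + s^2/2) * (1 - s^2/2)\<close> is at most 1; when the
      second factor is not positive the bound is trivial.\<close>
    have "norm y * (1 - s\<^sup>2/2) < y \<bullet> e"
    proof (cases "s\<^sup>2 < 2")
      case True
      then have "norm y * (1 - s\<^sup>2/2) < (y \<bullet> e) * (1 + s\<^sup>2 / 2) * (1 - s\<^sup>2/2)"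
        by (intro mult_strict_right_mono *) auto
      also have "\<dots> = (y \<bullet> e) * (1 - (s\<^sup>2/2)\<^sup>2)" by (simp add: field_simps power2_eq_square)
      also have "\<dots> \<le> y \<bullet> e" using y by (simp add: mult_le_cancel_left1)
      finally show ?thesis .
    next
      case False
      then have "norm y * (1 - s\<^sup>2/2) \<le> 0" by (intro mult_nonneg_nonpos) auto
      then show ?thesis using y by simp
    qed
    then have "1 - s\<^sup>2/2 < (y /\<^sub>R norm y) \<bullet> e" using y0 by (simp add: field_simps)
    moreover have "(dist (y /\<^sub>R norm y) e)\<^sup>2 = 2 - 2 * ((y /\<^sub>R norm y) \<bullet> e)"
      using dot_norm_neg[of "y /\<^sub>R norm y" e] y0 e by (simp add: dist_norm field_simps)
    ultimately have "(dist (y /\<^sub>R norm y) e)\<^sup>2 < s\<^sup>2" by simp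
    then show ?thesis using s by (simp add: power2_less_imp_less)
  qed
  ultimately show ?thesis using y0 by (simp add: cap_cone_def)
qed

text \<open>The slice at height \<open>h\<close> is a ball of radius \<open>h * s\<close> in the
  other coordinates; integrating the power of \<open>h\<close> over the height gives the factor
  \<open>H ^ DIM('a) / DIM('a)\<close>.\<close>

lemma emeasure_coordinate_cone:
  fixes e :: "'a::euclidean_space"
  assumes e: "e \<in> Basis" and s: "0 < s" and H: "0 < H"
  shows "emeasure lborel {y. 0 < y \<bullet> e \<and> y \<bullet> e < H \<and> sqrt (\<Sum>i\<in>Basis - {e}. (y \<bullet> i)\<^sup>2) \<le> y \<bullet> e * s}
    = ennreal (unit_ball_vol (real (DIM('a) - 1)) * s ^ (DIM('a) - 1) * H ^ DIM('a) / real (DIM('a)))"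
    (is "emeasure lborel ?T = _")
proof -
  interpret product_sigma_finite "\<lambda>_::'a. lborel :: real measure" by standard
  define A where "A = Basis - {e}"
  have A: "finite A" "e \<notin> A" "insert e A = Basis" using e by (auto simp: A_def)
  have cA: "card A = DIM('a) - 1" using e by (simp add: A_def)
  let ?M = "\<Pi>\<^sub>M i\<in>Basis. (lborel :: real measure)" let ?N = "\<Pi>\<^sub>M i\<in>A. (lborel :: real measure)"
  let ?\<phi> = "\<lambda>f::'a \<Rightarrow> real. if 0 < f e \<and> f e < H \<and> sqrt (\<Sum>i\<in>A. (f i)\<^sup>2) \<le> f e * s then 1 else 0 :: ennreal"
  have T: "?T \<in> sets borel" by measurable
  have comp: "(\<lambda>f. f i) \<in> borel_measurable (Pi\<^sub>M (insert e A) (\<lambda>_. lborel :: real measure))" if "i \<in> insert e A" for i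
    using measurable_component_singleton[OF that, of "\<lambda>_. lborel :: real measure"] by simp
  have sq: "(\<lambda>f. sqrt (\<Sum>i\<in>A. (f i)\<^sup>2)) \<in> borel_measurable (Pi\<^sub>M (insert e A) (\<lambda>_. lborel :: real measure))"
    by (rule measurable_compose[where g = sqrt and N = borel],
        intro borel_measurable_sum borel_measurable_power comp insertI2) auto
  define W where "W = {f \<in> space (Pi\<^sub>M (insert e A) (\<lambda>_. lborel :: real measure)). 0 < f e} \<inter>
    {f \<in> space (Pi\<^sub>M (insert e A) (\<lambda>_. lborel :: real measure)). f e < H} \<inter>
    {f \<in> space (Pi\<^sub>M (insert e A) (\<lambda>_. lborel :: real measure)). sqrt (\<Sum>i\<in>A. (f i)\<^sup>2) \<le> f e * s}"
  have "W \<in> sets (Pi\<^sub>M (insert e A) (\<lambda>_. lborel))"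
    unfolding W_def
    by (intro sets.Int borel_measurable_less borel_measurable_le borel_measurable_times borel_measurable_const comp insertI1 sq)
  then have "indicator W \<in> borel_measurable (\<Pi>\<^sub>M i\<in>insert e A. lborel)"
    by (rule borel_measurable_indicator)
  then have meas: "?\<phi> \<in> borel_measurable (\<Pi>\<^sub>M i\<in>insert e A. lborel)"
    by (rule measurable_cong[THEN iffD1, rotated]) (simp add: W_def indicator_def)
  have "emeasure lborel ?T = (\<integral>\<^sup>+y. indicator ?T y \<partial>(lborel :: 'a measure))" using T by simp
  also have "\<dots> = (\<integral>\<^sup>+f. indicator ?T (\<Sum>b\<in>Basis. f b *\<^sub>R b) \<partial>?M)"
    by (subst lborel_eq, subst nn_integral_distr) (use T in auto)
  also have "\<dots> = (\<integral>\<^sup>+f. ?\<phi> f \<partial>?M)"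
    using e by (intro nn_integral_cong) (auto simp: indicator_def A_def)
  also have "\<dots> = (\<integral>\<^sup>+f. ?\<phi> f \<partial>(\<Pi>\<^sub>M i\<in>insert e A. lborel))" by (simp add: A(3))
  also have "\<dots> = (\<integral>\<^sup>+h. \<integral>\<^sup>+f. ?\<phi> (f(e := h)) \<partial>?N \<partial>lborel)"
    by (rule product_nn_integral_insert_rev[OF A(1,2) meas])
  also have "\<dots> = (\<integral>\<^sup>+h. ennreal (unit_ball_vol (real (card A)) * s ^ card A * h ^ card A) * indicator {0..H} h \<partial>lborel)"
  proof (rule nn_integral_cong_AE)
    \<comment> \<open>The cone omits its two extreme heights while the primitive is taken over the
      closed interval; the difference is a null set.\<close>
    have "AE h in lborel. h \<noteq> (0::real)" "AE h in lborel. h \<noteq> H" by (rule AE_lborel_singleton)+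
    then show "AE h in lborel. (\<integral>\<^sup>+f. ?\<phi> (f(e := h)) \<partial>?N) =
        ennreal (unit_ball_vol (real (card A)) * s ^ card A * h ^ card A) * indicator {0..H} h"
    proof eventually_elim
      case (elim h)
      have sm: "(\<Sum>i\<in>A. ((f(e := h)) i)\<^sup>2) = (\<Sum>i\<in>A. (f i)\<^sup>2)" for f
        using A(2) by (intro sum.cong) auto
      show ?case
      proof (cases "0 < h \<and> h < H")
        case True
        have "(\<integral>\<^sup>+f. ?\<phi> (f(e := h)) \<partial>?N) =
            (\<integral>\<^sup>+f. indicator ({f. sqrt (\<Sum>i\<in>A. (f i)\<^sup>2) \<le> h * s} \<inter> space ?N) f \<partial>?N)"
          using True by (intro nn_integral_cong) (auto simp: indicator_def sm fun_upd_same simp del: fun_upd_apply)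
        also have "\<dots> = emeasure ?N ({f. sqrt (\<Sum>i\<in>A. (f i)\<^sup>2) \<le> h * s} \<inter> space ?N)"
          using A(1) by (subst nn_integral_indicator) auto
        also have "\<dots> = ennreal (unit_ball_vol (real (card A)) * (h * s) ^ card A)"
          using True s A(1) by (intro emeasure_cball_aux) auto
        finally show ?thesis using True by (simp add: power_mult_distrib mult_ac)
      next
        case False
        then show ?thesis using elim by (auto simp: indicator_def)
      qed
    qed
  qed
  also have "\<dots> = ennreal (unit_ball_vol (real (card A)) * s ^ card A * H ^ Suc (card A) / real (Suc (card A)) -
      unit_ball_vol (real (card A)) * s ^ card A * 0 ^ Suc (card A) / real (Suc (card A)))"
  proof (rule nn_integral_FTC_Icc)
    show "((\<lambda>h. unit_ball_vol (real (card A)) * s ^ card A * h ^ Suc (card A) / real (Suc (card A))) has_field_derivative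
        unit_ball_vol (real (card A)) * s ^ card A * h ^ card A) (at h)" for h
      by (rule derivative_eq_intros refl | simp)+
  qed (use s H in auto)
  also have "Suc (card A) = DIM('a)" using cA DIM_positive[where 'a='a] by simp
  finally show ?thesis using cA by (simp add: zero_power[OF DIM_positive])
qed

lemma emeasure_cap_cone_ge_Basis:
  fixes e :: "'a::euclidean_space"
  assumes "e \<in> Basis" "0 < s"
  shows "ennreal (unit_ball_vol (real (DIM('a) - 1)) * s ^ (DIM('a) - 1) * (1 / sqrt (1 + s\<^sup>2)) ^ DIM('a) / real (DIM('a)))
    \<le> emeasure lborel (cap_cone e s)"
proof -
  have "0 < 1 / sqrt (1 + s\<^sup>2)" by (simp add: add_pos_nonneg)
  note eq = emeasure_coordinate_cone[OF assms this]
  show ?thesis unfolding eq[symmetric]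
    by (intro emeasure_mono subsetI coordinate_cone_subset_cap_cone[OF assms(1) _ _ _ assms(2)])
       (auto simp: open_cap_cone)
qed

text \<open>The change-of-variables results of the library need a well-ordered index type; here a Vitali
  covering of \<open>U\<close> by disjoint balls is enough, as \<open>T\<close> maps balls to balls of the same radius.\<close>

lemma emeasure_isometry_ge:
  fixes T :: "'a::euclidean_space \<Rightarrow> 'a"
  assumes T: "\<And>x y. dist (T x) (T y) = dist x y" "surj T" and U: "open U" "open (T ` U)"
  shows "emeasure lborel U \<le> emeasure lborel (T ` U)"
proof -
  define K where "K = {(x, r). 0 < r \<and> ball x r \<subseteq> U}"
  obtain C where C: "countable C" "C \<subseteq> K"
    "pairwise (\<lambda>i j. disjnt (ball (fst i) (snd i)) (ball (fst j) (snd j))) C"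
    "negligible (U - (\<Union>i \<in> C. ball (fst i) (snd i)))"
  proof (rule Vitali_covering_theorem_balls[of U K fst snd])
    fix y :: 'a and d :: real assume "y \<in> U" "0 < d"
    then obtain r where r: "0 < r" "ball y r \<subseteq> U" using U(1) open_contains_ball by blast
    then have "(y, min r (d/2)) \<in> K" using \<open>0 < d\<close> by (auto simp: K_def)
    then show "\<exists>i. i \<in> K \<and> y \<in> ball (fst i) (snd i) \<and> snd i < d"
      using r \<open>0 < d\<close> by (intro exI[of _ "(y, min r (d/2))"]) auto
  qed blast
  define B where "B i = ball (fst i) (snd i)" for i :: "'a \<times> real"
  define B' where "B' i = ball (T (fst i)) (snd i)" for i :: "'a \<times> real"
  have TB: "T ` B i = B' i" for i
  proof
    show "B' i \<subseteq> T ` B i"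
    proof
      fix y assume y: "y \<in> B' i"
      obtain z where z: "y = T z" using T(2) by (meson surjD)
      then have "z \<in> B i" using y T(1) by (simp add: B_def B'_def)
      then show "y \<in> T ` B i" using z by blast
    qed
  qed (auto simp: B_def B'_def T(1))
  have inj: "inj T" by (rule injI) (metis T(1) dist_eq_0_iff)
  have sub: "(\<Union>i\<in>C. B i) \<subseteq> U" using C(2) unfolding K_def B_def by fastforce
  have disj: "disjoint_family_on B C"
    using C(3) by (auto simp: disjoint_family_on_def pairwise_def disjnt_def B_def)
  then have disj': "disjoint_family_on B' C"
    unfolding disjoint_family_on_def TB[symmetric] using image_Int[OF inj] by (metis image_empty)
  have "U - (\<Union>i\<in>C. B i) \<in> sets lborel"
    using U(1) by (simp add: B_def sets.Diff borel_open open_UN)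
  then have "U - (\<Union>i\<in>C. B i) \<in> null_sets lborel"
    using C(4) null_sets_completion_iff[of "U - (\<Union>i\<in>C. B i)" lborel]
    by (simp add: negligible_iff_null_sets B_def)
  then have "emeasure lborel U = emeasure lborel (\<Union>i\<in>C. B i)"
    using emeasure_Un_null_set[of "\<Union>i\<in>C. B i" lborel "U - (\<Union>i\<in>C. B i)"] sub
    by (simp add: Un_absorb1 B_def borel_open open_UN)
  also have "\<dots> = (\<integral>\<^sup>+i. emeasure lborel (B i) \<partial>count_space C)"
    by (rule emeasure_UN_countable[OF _ C(1) disj]) (simp add: B_def)
  also have "\<dots> = (\<integral>\<^sup>+i. emeasure lborel (B' i) \<partial>count_space C)"
    using C(2) by (intro nn_integral_cong) (auto simp: B_def B'_def emeasure_ball K_def)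
  also have "\<dots> = emeasure lborel (\<Union>i\<in>C. B' i)"
    by (rule emeasure_UN_countable[OF _ C(1) disj', symmetric]) (simp add: B'_def)
  also have "\<dots> \<le> emeasure lborel (T ` U)"
    using sub U(2) by (intro emeasure_mono) (auto simp: TB[symmetric])
  finally show ?thesis .
qed

text \<open>A rotation taking a basis vector to \<open>x\<close> commutes with radial projection and
  preserves distances, so it carries one cap cone onto the other.\<close>

lemma emeasure_cap_cone_ge:
  fixes x :: "real ^ 'n"
  assumes x: "norm x = 1" and "0 < s"
  shows "ennreal (unit_ball_vol (real (CARD('n) - 1)) * s ^ (CARD('n) - 1) * (1 / sqrt (1 + s\<^sup>2)) ^ CARD('n) / real (CARD('n)))
    \<le> emeasure lborel (cap_cone x s)"
proof -
  obtain e :: "real ^ 'n" where e: "e \<in> Basis" using nonempty_Basis by blast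
  obtain T where T: "orthogonal_transformation T" "T e = x"
    using orthogonal_transformation_exists_1[of e x] e x by auto
  have TT: "T (y /\<^sub>R r) = T y /\<^sub>R r" for y r
    using T(1) by (simp add: orthogonal_transformation_linear linear_cmul)
  have dist: "dist (T y) (T z) = dist y z" for y z
    using T(1) by (simp add: orthogonal_transformation_isometry)
  have norm: "norm (T y) = norm y" for y
    using T(1) by (simp add: orthogonal_transformation_norm)
  have mem: "T y \<in> cap_cone x s \<longleftrightarrow> y \<in> cap_cone e s" for y
  proof -
    have "T y = 0 \<longleftrightarrow> y = 0" using norm[of y] by (metis norm_eq_zero)
    moreover have "dist (T y /\<^sub>R norm (T y)) x = dist (y /\<^sub>R norm y) e"
      using dist[of "y /\<^sub>R norm y" e] by (simp add: TT T(2) norm)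
    ultimately show ?thesis by (simp add: cap_cone_def norm)
  qed
  have eq: "cap_cone x s = T ` cap_cone e s"
  proof
    show "cap_cone x s \<subseteq> T ` cap_cone e s"
    proof
      fix y assume "y \<in> cap_cone x s"
      moreover obtain z where "y = T z" using orthogonal_transformation_surj[OF T(1)] by (meson surjD)
      ultimately show "y \<in> T ` cap_cone e s" using mem by blast
    qed
  qed (use mem in auto)
  have "emeasure lborel (cap_cone e s) \<le> emeasure lborel (T ` cap_cone e s)"
    by (rule emeasure_isometry_ge[OF dist orthogonal_transformation_surj[OF T(1)]])
       (auto simp: eq[symmetric] open_cap_cone)
  then show ?thesis
    using emeasure_cap_cone_ge_Basis[OF e \<open>0 < s\<close>] by (simp add: eq)
qed

text \<open>Disjoint Vitali balls centred on the sphere have disjoint cap cones in the unit ball,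
  which bounds the sum of \<open>\<kappa> * r m ^ d\<close>. Covering the sphere requires enlarged
  balls and would cost a factor \<open>5 ^ d\<close>; this price is paid only on the tail of the
  convergent sum. An enlarged ball has radius at most \<open>5 * t\<close>, hence the
  \<open>10 * t\<close>.\<close>

lemma sphere_covered_by_caps:
  fixes t \<epsilon> :: real
  assumes t: "0 < t" and \<epsilon>: "0 < \<epsilon>"
  shows "hausdorff_pre (CARD('n) - 1) (10 * t) (sphere 0 1 :: (real ^ 'n) set) \<le>
    ennreal (sqrt (1 + t\<^sup>2) ^ CARD('n) * (real (CARD('n)) * unit_ball_vol (real (CARD('n)))) + \<epsilon>)"
proof -
  define d where "d = CARD('n) - 1"
  define \<kappa> where "\<kappa> = unit_ball_vol (real d)"
  have \<kappa>: "0 \<le> \<kappa>" by (simp add: \<kappa>_def)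
  define F where "F = sqrt (1 + t\<^sup>2) ^ CARD('n) * real (CARD('n))"
  have F: "0 < F" by (simp add: F_def add_pos_nonneg)
  define K where "K = {(y :: real ^ 'n, \<rho>). y \<in> sphere 0 1 \<and> 0 < \<rho> \<and> \<rho> \<le> t}"
  obtain C where C: "countable C" "C \<subseteq> K"
     "pairwise (\<lambda>i j. disjnt (cball (fst i) (snd i)) (cball (fst j) (snd j))) C"
     "\<And>i. i \<in> K \<Longrightarrow> \<exists>j. j \<in> C \<and> \<not> disjnt (cball (fst i) (snd i)) (cball (fst j) (snd j)) \<and>
                        cball (fst i) (snd i) \<subseteq> ball (fst j) (5 * snd j)"
  proof (rule Vitali_covering_lemma_cballs_balls[of K snd t fst])
    show "0 < snd i \<and> snd i \<le> t" if "i \<in> K" for i using that by (auto simp: K_def)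
  qed (rule that)
  \<comment> \<open>The Vitali family may be finite, so it is indexed by a subset of the
    naturals.\<close>
  define I where "I = to_nat_on C ` C"
  define c where "c m = fst (from_nat_into C m)" for m
  define r where "r m = snd (from_nat_into C m)" for m
  have inI: "from_nat_into C m \<in> C" "to_nat_on C (from_nat_into C m) = m" if "m \<in> I" for m
    using that C(1) by (auto simp: I_def)
  have cr: "norm (c m) = 1" "0 < r m" "r m \<le> t" if "m \<in> I" for m
    using subsetD[OF C(2) inI(1)[OF that]] by (auto simp: K_def c_def r_def)
  have disj: "cball (c m) (r m) \<inter> cball (c m') (r m') = {}" if "m \<in> I" "m' \<in> I" "m \<noteq> m'" for m m'
  proof -
    have "from_nat_into C m \<noteq> from_nat_into C m'" using inI(2) that by metis
    then show ?thesis using C(3) inI(1) that unfolding pairwise_def disjnt_def c_def r_def by blast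
  qed
  have cov: "\<exists>m\<in>I. cball y \<rho> \<inter> cball (c m) (r m) \<noteq> {} \<and> y \<in> cball (c m) (5 * r m)"
    if "norm y = 1" "0 < \<rho>" "\<rho> \<le> t" for y \<rho>
  proof -
    have "(y, \<rho>) \<in> K" using that by (simp add: K_def)
    then obtain j where j: "j \<in> C" "cball y \<rho> \<inter> cball (fst j) (snd j) \<noteq> {}" "cball y \<rho> \<subseteq> ball (fst j) (5 * snd j)"
      using C(4)[of "(y, \<rho>)"] unfolding disjnt_def fst_conv snd_conv by blast
    have "y \<in> ball (fst j) (5 * snd j)" by (rule subsetD[OF j(3)]) (use that in simp)
    with j show ?thesis
      using C(1) by (intro bexI[of _ "to_nat_on C j"]) (auto simp: c_def r_def I_def)
  qed
  define v where "v m = (if m \<in> I then \<kappa> * r m ^ d else 0)" for m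
  have v0: "0 \<le> v m" for m using \<kappa> cr by (simp add: v_def less_imp_le)
  define W where "W m = (if m \<in> I then cap_cone (c m) (r m) else {})" for m
  have Wsets: "W m \<in> sets lborel" for m by (simp add: W_def open_cap_cone)
  have Wc: "m \<in> I \<and> y /\<^sub>R norm y \<in> cball (c m) (r m)" if "y \<in> W m" for y m
    using that by (simp add: W_def cap_cone_def dist_commute split: if_splits)
  have disjW: "disjoint_family W"
    unfolding disjoint_family_on_def
  proof (intro ballI impI)
    fix m m' :: nat assume "m \<noteq> m'"
    then show "W m \<inter> W m' = {}"
      using disj[of m m'] Wc[of _ m] Wc[of _ m'] by blast
  qed
  have vW: "ennreal (v m) \<le> ennreal F * emeasure lborel (W m)" for m
  proof (cases "m \<in> I")
    case True
    note m = cr[OF True]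
    have "sqrt (1 + (r m)\<^sup>2) \<le> sqrt (1 + t\<^sup>2)" using m by (simp add: power_mono)
    then have q: "(1 / sqrt (1 + t\<^sup>2)) ^ CARD('n) \<le> (1 / sqrt (1 + (r m)\<^sup>2)) ^ CARD('n)"
      by (intro power_mono divide_left_mono) (auto simp: add_pos_nonneg)
    have "v m = F * (\<kappa> * r m ^ d * (1 / sqrt (1 + t\<^sup>2)) ^ CARD('n) / real (CARD('n)))"
      using True by (simp add: v_def F_def power_divide add_nonneg_eq_0_iff)
    also have "\<dots> \<le> F * (\<kappa> * r m ^ d * (1 / sqrt (1 + (r m)\<^sup>2)) ^ CARD('n) / real (CARD('n)))"
      using F \<kappa> m q by (intro mult_left_mono divide_right_mono) auto
    finally have "ennreal (v m) \<le> ennreal F * ennreal (\<kappa> * r m ^ d * (1 / sqrt (1 + (r m)\<^sup>2)) ^ CARD('n) / real (CARD('n)))"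
      using F \<kappa> m by (simp add: ennreal_mult[symmetric] ennreal_leI)
    also have "\<dots> \<le> ennreal F * emeasure lborel (W m)"
      using emeasure_cap_cone_ge[OF m(1,2)] True
      by (intro mult_left_mono) (simp_all add: W_def d_def \<kappa>_def)
    finally show ?thesis .
  qed (simp add: v_def)
  have "(\<Sum>m. ennreal (v m)) \<le> (\<Sum>m. ennreal F * emeasure lborel (W m))"
    by (intro suminf_le summableI vW)
  also have "\<dots> = ennreal F * emeasure lborel (\<Union>m. W m)"
    using Wsets disjW by (subst ennreal_suminf_cmult, subst suminf_emeasure) auto
  also have "\<dots> \<le> ennreal F * emeasure lborel (ball 0 1 :: (real ^ 'n) set)"
    by (intro mult_left_mono emeasure_mono) (auto simp: W_def cap_cone_def split: if_splits)
  also have "\<dots> = ennreal (F * unit_ball_vol (real (CARD('n))))"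
    using F by (simp add: emeasure_ball ennreal_mult)
  finally have sumv: "(\<Sum>m. ennreal (v m)) \<le> ennreal (F * unit_ball_vol (real (CARD('n))))" .
  have summ: "summable v"
    using sumv by (intro summable_suminf_not_top v0) (auto simp: top_unique)
  have sumv': "suminf v \<le> F * unit_ball_vol (real (CARD('n)))"
    using sumv F by (simp add: suminf_ennreal2[OF v0 summ])
  have "0 < \<epsilon> / 5 ^ d" using \<epsilon> by simp
  \<comment> \<open>Beyond \<open>N\<close> even the enlarged balls contribute less than
    \<epsilon>.\<close>
  then obtain N where N: "\<forall>n\<ge>N. norm (\<Sum>i. v (i + n)) < \<epsilon> / 5 ^ d"
    using suminf_exist_split[OF _ summ] by blast
  define w where "w m = (if m < N then 0 else 5 ^ d * v m)" for m
  have w: "(\<lambda>m. w (m + N)) sums (5 ^ d * (\<Sum>i. v (i + N)))"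
    unfolding w_def by (simp add: summ sums_mult summable_sums summable_ignore_initial_segment)
  have "w sums (5 ^ d * (\<Sum>i. v (i + N)))"
    using w sums_iff_shift[of w N] by (simp add: w_def)
  then have sw: "summable w" "suminf w < \<epsilon>"
    using N by (auto simp: sums_iff field_simps abs_less_iff)
  have w0: "0 \<le> w m" for m using v0 by (simp add: w_def)
  define U where "U m = (if m \<in> I then cball (c m) (if m < N then r m else 5 * r m) else {})" for m
  have "sphere 0 1 \<subseteq> (\<Union>m. U m)"
  proof
    fix y :: "real ^ 'n" assume "y \<in> sphere 0 1"
    then have y: "norm y = 1" by simp
    show "y \<in> (\<Union>m. U m)"
    proof (cases "\<exists>m\<in>I. m < N \<and> y \<in> cball (c m) (r m)")
      case True
      then obtain m where "m \<in> I" "m < N" "y \<in> cball (c m) (r m)" by blast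
      then have "y \<in> U m" by (simp add: U_def)
      then show ?thesis by blast
    next
      case False
      \<comment> \<open>\<open>Z\<close> is closed, being a finite union of closed balls, so a small
        ball about \<open>y\<close> misses it. The Vitali ball which that small ball meets thus has
        index at least \<open>N\<close>, and its fivefold enlargement contains
        \<open>y\<close>.\<close>
      define Z where "Z = (\<Union>m\<in>I \<inter> {..<N}. cball (c m) (r m))"
      have "closed Z" unfolding Z_def by (intro closed_UN) auto
      moreover have "y \<notin> Z" using False by (auto simp: Z_def)
      ultimately obtain \<rho> where \<rho>: "0 < \<rho>" "cball y \<rho> \<subseteq> - Z"
        using open_contains_cball[of "- Z"] by (auto simp: closed_def)
      have "0 < min \<rho> t" "min \<rho> t \<le> t" using \<rho> t by auto
      then obtain m where m: "m \<in> I" "cball y (min \<rho> t) \<inter> cball (c m) (r m) \<noteq> {}" "y \<in> cball (c m) (5 * r m)"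
        using cov[OF y] by blast
      have "cball y (min \<rho> t) \<subseteq> cball y \<rho>" by (simp add: subset_cball)
      then have "\<not> m < N" using m(1,2) \<rho>(2) by (auto simp: Z_def)
      then have "y \<in> U m" using m by (simp add: U_def)
      then show ?thesis by blast
    qed
  qed
  moreover have "bounded (U m) \<and> diameter (U m) \<le> 10 * t" for m
    using cr[of m] t by (auto simp: U_def)
  ultimately have "hausdorff_pre d (10 * t) (sphere 0 1 :: (real ^ 'n) set) \<le>
      (\<Sum>m. if U m = {} then 0 else ennreal (unit_ball_vol (real d) * (diameter (U m) / 2) ^ d))"
    unfolding hausdorff_pre_def by (intro INF_lower) auto
  also have "\<dots> \<le> (\<Sum>m. ennreal (v m + w m))"
  proof (intro suminf_le summableI)
    fix m
    show "(if U m = {} then 0 else ennreal (unit_ball_vol (real d) * (diameter (U m) / 2) ^ d)) \<le> ennreal (v m + w m)"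
    proof (cases "m \<in> I")
      case True
      then have "unit_ball_vol (real d) * (diameter (U m) / 2) ^ d \<le> v m + w m"
        using cr(2)[OF True] v0[of m] by (simp add: U_def v_def w_def \<kappa>_def power_mult_distrib mult_ac)
      then show ?thesis by (simp add: ennreal_leI)
    qed (simp add: U_def)
  qed
  also have "\<dots> = ennreal (suminf v + suminf w)"
    using v0 w0 summ sw(1) by (subst suminf_ennreal2) (auto simp: suminf_add summable_add add_nonneg_nonneg)
  also have "\<dots> \<le> ennreal (F * unit_ball_vol (real (CARD('n))) + \<epsilon>)"
    using sumv' sw(2) by (intro ennreal_leI) simp
  finally show ?thesis by (simp add: d_def F_def mult.assoc)
qed

text \<open>The radius \<open>t\<close> of the covering balls serves at the same time as the error
  term, so letting \<open>t\<close> tend to 0 removes both losses.\<close>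

lemma unit_sphere_area_le:
  "unit_sphere_area TYPE(real ^ 'n) \<le> real (CARD('n)) * unit_ball_vol (real (CARD('n)))"
proof -
  define A where "A = real (CARD('n)) * unit_ball_vol (real (CARD('n)))"
  define d where "d = CARD('n) - 1"
  define S where "S = (sphere 0 1 :: (real ^ 'n) set)"
  have A: "0 \<le> A" by (simp add: A_def)
  have "hausdorff_outer d S \<le> ennreal A"
    unfolding hausdorff_outer_def
  proof (rule SUP_least)
    fix \<delta> :: real assume "\<delta> \<in> {0<..}"
    then have \<delta>: "0 < \<delta>" by simp
    have "hausdorff_pre d \<delta> S \<le> ennreal (sqrt (1 + t\<^sup>2) ^ CARD('n) * A + t)" if "0 < t" "10 * t < \<delta>" for t
    proof -
      have "hausdorff_pre d \<delta> S \<le> hausdorff_pre d (10 * t) S"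
        unfolding hausdorff_pre_def by (rule INF_superset_mono) (use that in \<open>auto intro: order_trans\<close>)
      also have "\<dots> \<le> ennreal (sqrt (1 + t\<^sup>2) ^ CARD('n) * A + t)"
        using sphere_covered_by_caps[OF that(1,1), where 'n='n] by (simp add: S_def d_def A_def)
      finally show ?thesis .
    qed
    moreover have "\<forall>\<^sub>F t in at_right 0. 0 < t \<and> 10 * t < \<delta>"
      using \<delta> eventually_at_right[of 0 "\<delta>/10"] by (auto intro!: exI[of _ "\<delta>/10"] simp: eventually_at_right_field)
    ultimately have ev: "\<forall>\<^sub>F t in at_right 0. hausdorff_pre d \<delta> S \<le> ennreal (sqrt (1 + t\<^sup>2) ^ CARD('n) * A + t)"
      by (auto elim!: eventually_mono)
    have "((\<lambda>t. sqrt (1 + t\<^sup>2) ^ CARD('n) * A + t) \<longlongrightarrow> sqrt (1 + 0\<^sup>2) ^ CARD('n) * A + 0) (at_right 0)"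
      by (intro tendsto_intros)
    then have "((\<lambda>t. ennreal (sqrt (1 + t\<^sup>2) ^ CARD('n) * A + t)) \<longlongrightarrow> ennreal A) (at_right 0)"
      by (intro tendsto_ennrealI) simp
    then show "hausdorff_pre d \<delta> S \<le> ennreal A"
      by (rule tendsto_lowerbound[OF _ ev]) simp
  qed
  \<comment> \<open>On a set outside the sigma-algebra \<open>measure\<close> has the default value
    0, and the bound holds there as well.\<close>
  then have "measure (hausdorff_measure d) S \<le> A"
    using A emeasure_hausdorff_measure[of S d] measure_notin_sets[of S "hausdorff_measure d"]
    by (cases "S \<in> sets (hausdorff_measure d)") (auto simp: measure_def enn2real_leI)
  then show ?thesis by (simp add: unit_sphere_area_def A_def d_def S_def)
qed


section \<open>Integration along rays\<close>

lemma nn_integral_lborel_scale: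
  fixes g :: "'a::euclidean_space \<Rightarrow> ennreal"
  assumes [measurable]: "g \<in> borel_measurable borel" and t: "0 < t"
  shows "(\<integral>\<^sup>+z. g z \<partial>lborel) = ennreal (t ^ DIM('a)) * (\<integral>\<^sup>+x. g (t *\<^sub>R x) \<partial>lborel)"
  using t by (subst lborel_affine[of t 0])
    (simp_all add: nn_integral_density nn_integral_distr nn_integral_cmult)

lemma nn_integral_inverse_power_tail:
  fixes a :: real
  assumes "0 < a" "0 < N"
  shows "(\<integral>\<^sup>+t. ennreal (1 / t ^ Suc N) * indicator {u. a < u} t \<partial>lborel) = ennreal (1 / (real N * a ^ N))"
proof -
  have "(\<integral>\<^sup>+t. ennreal (1 / t ^ Suc N) * indicator {u. a < u} t \<partial>lborel) =
      (\<integral>\<^sup>+t. ennreal (1 / t ^ Suc N) * indicator {a..} t \<partial>lborel)"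
    using AE_lborel_singleton[of a]
    by (intro nn_integral_cong_AE) (auto elim!: eventually_mono simp: indicator_def)
  also have "\<dots> = ennreal (0 - (- 1 / (real N * a ^ N)))"
  proof (rule nn_integral_FTC_atLeast)
    show "((\<lambda>t. - 1 / (real N * t ^ N)) has_field_derivative 1 / t ^ Suc N) (at t)" if "a \<le> t" for t
    proof -
      have "t \<noteq> 0" using that assms by simp
      obtain M where M: "N = Suc M" using \<open>0 < N\<close> not0_implies_Suc by blast
      show ?thesis
        unfolding M
        by (rule derivative_eq_intros refl)+ (use \<open>t \<noteq> 0\<close> in \<open>auto simp: field_simps simp del: of_nat_Suc\<close>)
    qed
    show "((\<lambda>t. - 1 / (real N * t ^ N)) \<longlongrightarrow> 0) at_top"
      using assms by (intro tendsto_divide_0[OF tendsto_const] filterlim_at_top_imp_at_infinity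
        filterlim_tendsto_pos_mult_at_top[OF tendsto_const] filterlim_pow_at_top filterlim_ident) auto
  qed (use assms in auto)
  finally show ?thesis by simp
qed

text \<open>Evaluate the integral of \<open>t ^ (N - 1) * norm x ^ N * h (t *\<^sub>R x)\<close> over \<open>t > 0\<close> and \<open>norm x < 1\<close>, where
  \<open>N\<close> is the dimension, in both orders.\<close>

lemma nn_integral_ge_of_rays:
  fixes h :: "'a::euclidean_space \<Rightarrow> ennreal"
  assumes h[measurable]: "h \<in> borel_measurable borel"
    and L: "\<And>\<theta>. norm \<theta> = 1 \<Longrightarrow>
      L \<le> (\<integral>\<^sup>+u. ennreal (u ^ (DIM('a) - 1)) * h (u *\<^sub>R \<theta>) * indicator {0<..} u \<partial>lborel)"
  shows "L * ennreal (real DIM('a) * unit_ball_vol (real DIM('a))) \<le> (\<integral>\<^sup>+x. h x \<partial>lborel)"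
proof -
  define N where "N = DIM('a)"
  have N: "0 < N" "Suc (N - 1) = N" by (simp_all add: N_def)
  define G where "G x t = ennreal (t ^ (N - 1) * norm x ^ N) * h (t *\<^sub>R x) * indicator {0<..} t * indicator (ball 0 1) x"
    for x :: 'a and t :: real
  have [measurable]: "ball (0::'a) 1 \<in> sets borel" by simp
  have [measurable]: "case_prod G \<in> borel_measurable (lborel \<Otimes>\<^sub>M lborel)"
    unfolding G_def by measurable
  have "L * ennreal (unit_ball_vol (real N)) = (\<integral>\<^sup>+x. L * indicator (ball 0 1 :: 'a set) x \<partial>lborel)"
    by (simp add: nn_integral_cmult_indicator emeasure_ball N_def)
  also have "\<dots> \<le> (\<integral>\<^sup>+x. \<integral>\<^sup>+t. G x t \<partial>lborel \<partial>lborel)"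
  proof (rule nn_integral_mono_AE)
    show "AE x in lborel. L * indicator (ball 0 1) x \<le> (\<integral>\<^sup>+t. G x t \<partial>lborel)"
      using AE_lborel_singleton[of "0::'a"]
    proof eventually_elim
      case (elim x)
      show ?case
      proof (cases "norm x < 1")
        case True
        define \<theta> where "\<theta> = x /\<^sub>R norm x"
        have \<theta>: "norm \<theta> = 1" "x = norm x *\<^sub>R \<theta>" using elim by (auto simp: \<theta>_def)
        have nx: "0 < norm x" using elim by simp
        have "L \<le> (\<integral>\<^sup>+u. ennreal (u ^ (N - 1)) * h (u *\<^sub>R \<theta>) * indicator {0<..} u \<partial>lborel)"
          unfolding N_def by (rule L[OF \<theta>(1)])
        \<comment> \<open>Substitution \<open>u = norm x * t\<close>: its Jacobian and the rescaled
          weight together make up the factor \<open>norm x ^ N\<close> of \<open>G\<close>.\<close>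
        also have "\<dots> = ennreal (norm x) *
            (\<integral>\<^sup>+t. ennreal ((norm x * t) ^ (N - 1)) * h ((norm x * t) *\<^sub>R \<theta>) * indicator {0<..} (norm x * t) \<partial>lborel)"
          using nx by (subst nn_integral_real_affine[where c = "norm x" and t = 0]) auto
        also have "\<dots> = (\<integral>\<^sup>+t. ennreal (norm x) *
            (ennreal ((norm x * t) ^ (N - 1)) * h ((norm x * t) *\<^sub>R \<theta>) * indicator {0<..} (norm x * t)) \<partial>lborel)"
          by (subst nn_integral_cmult) auto
        also have "\<dots> = (\<integral>\<^sup>+t. G x t \<partial>lborel)"
        proof (intro nn_integral_cong)
          fix t :: real
          have "(norm x * t) *\<^sub>R \<theta> = t *\<^sub>R x" by (metis \<theta>(2) mult.commute scaleR_scaleR)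
          moreover have "norm x * (norm x * t) ^ (N - 1) = t ^ (N - 1) * norm x ^ N"
            by (subst (2) N(2)[symmetric]) (simp add: power_mult_distrib mult_ac)
          ultimately show "ennreal (norm x) *
            (ennreal ((norm x * t) ^ (N - 1)) * h ((norm x * t) *\<^sub>R \<theta>) * indicator {0<..} (norm x * t)) = G x t"
            using nx True
            by (cases "0 < t") (auto simp: G_def indicator_def zero_less_mult_iff mult.assoc[symmetric] ennreal_mult[symmetric])
        qed
        finally show ?thesis using True by simp
      qed simp
    qed
  qed
  also have "\<dots> = (\<integral>\<^sup>+t. \<integral>\<^sup>+x. G x t \<partial>lborel \<partial>lborel)"
    by (rule lborel_pair.Fubini'[symmetric]) measurable
  \<comment> \<open>For fixed \<open>t\<close>, substitute \<open>z = t *\<^sub>R x\<close>; the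
    condition \<open>norm x < 1\<close> becomes \<open>norm z < t\<close>, and the powers of
    \<open>t\<close> combine to \<open>1 / t ^ Suc N\<close>.\<close>
  also have "\<dots> = (\<integral>\<^sup>+t. \<integral>\<^sup>+z. ennreal (norm z ^ N) * h z * (ennreal (1 / t ^ Suc N) * indicator {u. norm z < u} t) \<partial>lborel \<partial>lborel)"
  proof (rule nn_integral_cong)
    fix t :: real
    show "(\<integral>\<^sup>+x. G x t \<partial>lborel) =
      (\<integral>\<^sup>+z. ennreal (norm z ^ N) * h z * (ennreal (1 / t ^ Suc N) * indicator {u. norm z < u} t) \<partial>lborel)"
    proof (cases "0 < t")
      case True
      have "(\<integral>\<^sup>+z. ennreal (norm z ^ N) * h z * (ennreal (1 / t ^ Suc N) * indicator {u. norm z < u} t) \<partial>(lborel :: 'a measure)) =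
        ennreal (t ^ N) * (\<integral>\<^sup>+x. ennreal (norm (t *\<^sub>R x) ^ N) * h (t *\<^sub>R x) *
           (ennreal (1 / t ^ Suc N) * indicator {u. norm (t *\<^sub>R x) < u} t) \<partial>lborel)"
        unfolding N_def by (rule nn_integral_lborel_scale[OF _ True]) measurable
      also have "\<dots> = (\<integral>\<^sup>+x. ennreal (t ^ N) * (ennreal (norm (t *\<^sub>R x) ^ N) * h (t *\<^sub>R x) *
           (ennreal (1 / t ^ Suc N) * indicator {u. norm (t *\<^sub>R x) < u} t)) \<partial>lborel)"
        by (subst nn_integral_cmult) auto
      also have "\<dots> = (\<integral>\<^sup>+x. G x t \<partial>lborel)"
      proof (intro nn_integral_cong)
        fix x :: 'a
        have "t ^ N * ((norm (t *\<^sub>R x)) ^ N) * (1 / t ^ Suc N) = t ^ (N - 1) * norm x ^ N"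
          using True N by (cases N) (auto simp: power_mult_distrib field_simps)
        moreover have "indicator {u. norm (t *\<^sub>R x) < u} t = (indicator {0<..} t * indicator (ball 0 1) x :: ennreal)"
          using True by (simp add: indicator_def)
        moreover have "ennreal a * (ennreal b * H * (ennreal c * i)) = ennreal (a * b * c) * H * i"
          if "0 \<le> a" "0 \<le> b" "0 \<le> c" for a b c :: real and H i :: ennreal
          using that by (simp add: ennreal_mult mult_ac)
        ultimately show "ennreal (t ^ N) * (ennreal (norm (t *\<^sub>R x) ^ N) * h (t *\<^sub>R x) *
           (ennreal (1 / t ^ Suc N) * indicator {u. norm (t *\<^sub>R x) < u} t)) = G x t"
          using True unfolding G_def by (simp add: mult.assoc del: norm_scaleR power_Suc)
      qed
      finally show ?thesis by simp
    next
      case False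
      then have "indicator {u. norm z < u} t = (0::ennreal)" for z :: 'a
        using norm_ge_zero[of z] by (auto simp: indicator_def simp del: norm_ge_zero)
      then show ?thesis using False by (simp add: G_def)
    qed
  qed
  also have "\<dots> = (\<integral>\<^sup>+z. \<integral>\<^sup>+t. ennreal (norm z ^ N) * h z * (ennreal (1 / t ^ Suc N) * indicator {u. norm z < u} t) \<partial>lborel \<partial>lborel)"
    by (rule lborel_pair.Fubini') measurable
  also have "\<dots> = (\<integral>\<^sup>+z. ennreal (1 / real N) * h z \<partial>lborel)"
  proof (rule nn_integral_cong_AE)
    show "AE z in lborel. (\<integral>\<^sup>+t. ennreal (norm z ^ N) * h z * (ennreal (1 / t ^ Suc N) * indicator {u. norm z < u} t) \<partial>lborel)
        = ennreal (1 / real N) * h z"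
      using AE_lborel_singleton[of "0::'a"]
    proof eventually_elim
      case (elim z)
      have "ennreal (norm z ^ N) * ennreal (1 / (real N * norm z ^ N)) = ennreal (1 / real N)"
        using elim by (subst ennreal_mult[symmetric]) auto
      then show ?case
        using elim N nn_integral_inverse_power_tail[of "norm z" N]
        by (subst nn_integral_cmult) (auto simp: mult.assoc mult.commute[of _ "h z"] simp del: power_Suc)
    qed
  qed
  also have "\<dots> = ennreal (1 / real N) * (\<integral>\<^sup>+z. h z \<partial>lborel)" by (subst nn_integral_cmult) auto
  finally have "ennreal (real N) * (L * ennreal (unit_ball_vol (real N))) \<le>
      ennreal (real N) * (ennreal (1 / real N) * (\<integral>\<^sup>+z. h z \<partial>lborel))"
    by (rule mult_left_mono) simp
  also have "\<dots> = (\<integral>\<^sup>+z. h z \<partial>lborel)"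
    using N by (simp add: mult.assoc[symmetric] ennreal_mult[symmetric])
  finally show ?thesis by (simp add: N_def ennreal_mult mult_ac)
qed

text \<open>Young's inequality for \<open>x\<close> and \<open>a powr (p - 1)\<close>, with equality
  at \<open>x = a\<close>. The factor \<open>u powr (- d / (p - 1))\<close> in \<open>a\<close> is
  chosen so that the coefficient of \<open>x\<close> on the left does not depend on
  \<open>u\<close>; integration then needs only the integral of \<open>x\<close>.\<close>

lemma Young_weighted:
  fixes p d u x l :: real
  assumes "1 < p" "0 < u" "0 \<le> x" "0 < l"
  shows "p * l powr (p - 1) * x \<le> u powr d * x powr p + (p - 1) * l powr p * u powr (- d / (p - 1))"
proof -
  define a where "a = l * u powr (- d / (p - 1))"
  have a: "0 < a" using assms by (simp add: a_def)
  define q where "q = p / (p - 1)"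
  have "x * (a powr (p - 1)) \<le> x powr p / p + (a powr (p - 1)) powr q / q"
    using assms a by (intro Youngs_inequality) (auto simp: q_def field_simps)
  also have "(a powr (p - 1)) powr q = a powr p" using assms by (simp add: powr_powr q_def)
  finally have "p * (x * a powr (p - 1)) \<le> p * (x powr p / p + a powr p / q)"
    using assms by (intro mult_left_mono) auto
  also have "\<dots> = x powr p + (p - 1) * a powr p" using assms by (simp add: q_def field_simps)
  finally have "u powr d * (p * (x * a powr (p - 1))) \<le> u powr d * (x powr p + (p - 1) * a powr p)"
    by (intro mult_left_mono) auto
  moreover have "u powr d * a powr (p - 1) = l powr (p - 1)"
    using assms by (simp add: a_def powr_mult powr_powr mult_ac powr_add[symmetric])
  moreover have "u powr d * a powr p = l powr p * u powr (- d / (p - 1))"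
  proof -
    have "d - d * p / (p - 1) = - d / (p - 1)" using assms by (simp add: field_simps)
    then show ?thesis
      using assms by (simp add: a_def powr_mult powr_powr mult_ac powr_add[symmetric])
  qed
  ultimately show ?thesis by (simp add: algebra_simps)
qed

lemma borel_measurable_epow [measurable]:
  assumes "f \<in> borel_measurable M"
  shows "(\<lambda>x. epow (f x) p) \<in> borel_measurable M"
proof (rule measurable_compose[OF assms])
  have "{x. x = (\<infinity>::ennreal)} \<in> sets borel" by simp
  moreover have "(\<lambda>x. ennreal (enn2real x powr p)) \<in> borel_measurable borel" by measurable
  ultimately show "(\<lambda>x. epow x p) \<in> borel_measurable borel"
    unfolding epow_def by (intro measurable_If) simp_all
qed

lemma nn_integral_epow_ray_ge:
  fixes g :: "real \<Rightarrow> ennreal" and p I r :: real and d :: nat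
  assumes [measurable]: "g \<in> borel_measurable borel" and p: "1 < p" and r: "0 < r"
    and I: "0 < I" "(\<integral>\<^sup>+u. ennreal (u powr (- real d / (p - 1))) * indicator {r..1} u \<partial>lborel) = ennreal I"
    and g: "1 \<le> (\<integral>\<^sup>+u. g u * indicator {r..1} u \<partial>lborel)"
  shows "ennreal (I powr (1 - p)) \<le> (\<integral>\<^sup>+u. ennreal (u ^ d) * epow (g u) p * indicator {r..1} u \<partial>lborel)"
proof -
  \<comment> \<open>The maximiser of \<open>p * l powr (p - 1) - (p - 1) * l powr p * I\<close>; the
    maximum is \<open>I powr (1 - p)\<close>.\<close>
  define l where "l = 1 / I"
  have l: "0 < l" using I by (simp add: l_def)
  have pt: "ennreal (p * l powr (p - 1)) * (g u * indicator {r..1} u) \<le>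
      ennreal (u ^ d) * epow (g u) p * indicator {r..1} u +
      ennreal ((p - 1) * l powr p) * (ennreal (u powr (- real d / (p - 1))) * indicator {r..1} u)" for u
  proof (cases "u \<in> {r..1}")
    case True
    then have u: "0 < u" using r by simp
    show ?thesis
    proof (cases "g u")
      case (real x)
      then have "ennreal (p * l powr (p - 1) * x) \<le>
          ennreal (u powr real d * x powr p + (p - 1) * l powr p * u powr (- real d / (p - 1)))"
        using Young_weighted[OF p u _ l] by (intro ennreal_leI) auto
      then show ?thesis
        using True real p l u by (simp add: epow_def ennreal_mult ennreal_plus powr_realpow[symmetric])
    next
      case top
      then show ?thesis using True u by (simp add: epow_def ennreal_mult_top)
    qed
  qed simp
  have "ennreal (p * l powr (p - 1)) \<le> ennreal (p * l powr (p - 1)) * (\<integral>\<^sup>+u. g u * indicator {r..1} u \<partial>lborel)"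
    using mult_left_mono[OF g, of "ennreal (p * l powr (p - 1))"] by simp
  also have "\<dots> = (\<integral>\<^sup>+u. ennreal (p * l powr (p - 1)) * (g u * indicator {r..1} u) \<partial>lborel)"
    by (subst nn_integral_cmult) auto
  also have "\<dots> \<le> (\<integral>\<^sup>+u. ennreal (u ^ d) * epow (g u) p * indicator {r..1} u +
      ennreal ((p - 1) * l powr p) * (ennreal (u powr (- real d / (p - 1))) * indicator {r..1} u) \<partial>lborel)"
    by (intro nn_integral_mono pt)
  also have "\<dots> = (\<integral>\<^sup>+u. ennreal (u ^ d) * epow (g u) p * indicator {r..1} u \<partial>lborel) +
      ennreal ((p - 1) * l powr p) * ennreal I"
    by (subst nn_integral_add, measurable, subst nn_integral_cmult, measurable, simp only: I(2))
  finally have *: "ennreal (p * l powr (p - 1)) \<le>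
      (\<integral>\<^sup>+u. ennreal (u ^ d) * epow (g u) p * indicator {r..1} u \<partial>lborel) + ennreal ((p - 1) * l powr p) * ennreal I"
    (is "_ \<le> ?X + _") .
  have "l powr p * I = l powr (p - 1)" using I by (simp add: l_def powr_diff powr_divide)
  then have B: "ennreal ((p - 1) * l powr p) * ennreal I = ennreal ((p - 1) * l powr (p - 1))"
    using p I by (simp add: ennreal_mult[symmetric] mult.assoc)
  have "I powr (1 - p) = l powr (p - 1)"
    using I by (simp add: l_def powr_divide powr_minus_divide[symmetric])
  moreover have "ennreal (l powr (p - 1)) \<le> ?X"
  proof (cases ?X)
    case (real X)
    then have "ennreal (p * l powr (p - 1)) \<le> ennreal (X + (p - 1) * l powr (p - 1))"
      using * B p by (simp add: ennreal_plus)
    then have "p * l powr (p - 1) \<le> X + (p - 1) * l powr (p - 1)"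
      using real p by (subst (asm) ennreal_le_iff) auto
    then show ?thesis using real by (simp add: algebra_simps ennreal_leI)
  qed simp
  ultimately show ?thesis by simp
qed

lemma nn_integral_epow_ge_of_rays:
  fixes G :: "'a::euclidean_space \<Rightarrow> ennreal" and p I r :: real
  assumes G[measurable]: "G \<in> borel_measurable borel" and p: "1 < p" and r: "0 < r"
    and I: "0 < I" "(\<integral>\<^sup>+u. ennreal (u powr (- real (DIM('a) - 1) / (p - 1))) * indicator {r..1} u \<partial>lborel) = ennreal I"
    and rays: "\<And>\<theta>. norm \<theta> = 1 \<Longrightarrow> 1 \<le> (\<integral>\<^sup>+u. G (u *\<^sub>R \<theta>) * indicator {r..1} u \<partial>lborel)"
  shows "ennreal (real DIM('a) * unit_ball_vol (real DIM('a)) * I powr (1 - p)) \<le> (\<integral>\<^sup>+x. epow (G x) p \<partial>lebesgue)"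
proof -
  have "ennreal (I powr (1 - p)) * ennreal (real DIM('a) * unit_ball_vol (real DIM('a))) \<le> (\<integral>\<^sup>+x. epow (G x) p \<partial>lborel)"
  proof (rule nn_integral_ge_of_rays)
    fix \<theta> :: 'a assume \<theta>: "norm \<theta> = 1"
    have "ennreal (I powr (1 - p)) \<le> (\<integral>\<^sup>+u. ennreal (u ^ (DIM('a) - 1)) * epow (G (u *\<^sub>R \<theta>)) p * indicator {r..1} u \<partial>lborel)"
      by (rule nn_integral_epow_ray_ge[OF _ p r I rays[OF \<theta>]]) measurable
    also have "\<dots> \<le> (\<integral>\<^sup>+u. ennreal (u ^ (DIM('a) - 1)) * epow (G (u *\<^sub>R \<theta>)) p * indicator {0<..} u \<partial>lborel)"
      using r by (intro nn_integral_mono mult_left_mono) (auto simp: indicator_def)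
    finally show "ennreal (I powr (1 - p)) \<le> \<dots>" .
  qed measurable
  then show ?thesis by (simp add: nn_integral_completion ennreal_mult[symmetric] mult_ac)
qed


section \<open>Images of ring families\<close>

lemma curve_length_radial:
  fixes \<gamma> :: "real \<Rightarrow> 'a::real_normed_vector"
  assumes "a \<le> b" "norm \<theta> = 1" and \<gamma>: "\<And>s. s \<in> {a..b} \<Longrightarrow> \<gamma> s = s *\<^sub>R \<theta>"
  shows "curve_length \<gamma> a b = ennreal (b - a)"
proof -
  have sum: "(\<Sum>i<n. ennreal (dist (\<gamma> (t i)) (\<gamma> (t (Suc i))))) = ennreal (b - a)"
    if t: "t 0 = a" "t n = b" "\<forall>i<n. t i \<le> t (Suc i)" for n :: nat and t
  proof -
    have "a \<le> t i" if "i \<le> n" for i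
      using that by (induction i) (use t in \<open>auto simp: Suc_le_eq intro: order_trans\<close>)
    moreover have "t i \<le> b" if "i \<le> n" for i
      using that by (induction i rule: inc_induct) (use t in \<open>auto intro: order_trans\<close>)
    ultimately have "dist (\<gamma> (t i)) (\<gamma> (t (Suc i))) = t (Suc i) - t i" if "i < n" for i
      using that t(3) assms(2) \<gamma>[of "t i"] \<gamma>[of "t (Suc i)"]
      by (simp add: dist_norm scaleR_left_diff_distrib[symmetric])
    then have "(\<Sum>i<n. ennreal (dist (\<gamma> (t i)) (\<gamma> (t (Suc i))))) = (\<Sum>i<n. ennreal (t (Suc i) - t i))"
      by (intro sum.cong) auto
    also have "\<dots> = ennreal (\<Sum>i<n. t (Suc i) - t i)" using t(3) by (intro sum_ennreal) auto
    finally show ?thesis using t by (simp add: sum_lessThan_telescope)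
  qed
  show ?thesis
    unfolding curve_length_def
  proof (rule antisym)
    show "(SUP (n, t)\<in>{(n, t). t 0 = a \<and> t n = b \<and> (\<forall>i<n. t i \<le> t (Suc i))}.
        \<Sum>i<n. ennreal (dist (\<gamma> (t i)) (\<gamma> (t (Suc i))))) \<le> ennreal (b - a)"
      by (rule SUP_least) (clarify, simp only: sum order_refl)
    show "ennreal (b - a) \<le> (SUP (n, t)\<in>{(n, t). t 0 = a \<and> t n = b \<and> (\<forall>i<n. t i \<le> t (Suc i))}.
        \<Sum>i<n. ennreal (dist (\<gamma> (t i)) (\<gamma> (t (Suc i)))))"
      using assms(1) sum[of "\<lambda>i. if i = 0 then a else b" 1]
      by (intro SUP_upper2[of "(1, \<lambda>i. if i = 0 then a else b)"]) auto
  qed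
qed

text \<open>A radial segment is parametrised by arc length up to the shift by \<open>a\<close>: its
  length up to \<open>t\<close> is \<open>t - a\<close>, which forces the choice in
  \<open>normal_representation\<close>.\<close>

lemma line_integral_radial:
  fixes \<gamma> :: "real \<Rightarrow> 'a::euclidean_space"
  assumes [measurable]: "\<rho> \<in> borel_measurable borel"
    and "a \<le> b" "norm \<theta> = 1" and \<gamma>: "\<And>s. s \<in> {a..b} \<Longrightarrow> \<gamma> s = s *\<^sub>R \<theta>"
  shows "line_integral \<rho> \<gamma> a b = (\<integral>\<^sup>+u. \<rho> (u *\<^sub>R \<theta>) * indicator {a..b} u \<partial>lborel)"
proof -
  have len: "curve_length \<gamma> a t = ennreal (t - a)" if "t \<in> {a..b}" for t
    by (rule curve_length_radial[OF _ assms(3)]) (use that \<gamma> in auto)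
  have nr: "normal_representation \<gamma> a b s = (a + s) *\<^sub>R \<theta>" if "s \<in> {0..b - a}" for s
  proof -
    have "(SOME t. t \<in> {a..b} \<and> curve_length \<gamma> a t = ennreal s) = a + s"
      by (rule some_equality) (use that len in auto)
    then show ?thesis using that by (simp add: normal_representation_def \<gamma>)
  qed
  have "line_integral \<rho> \<gamma> a b = (\<integral>\<^sup>+s. \<rho> ((a + s) *\<^sub>R \<theta>) * indicator {a..b} (a + s) \<partial>lborel)"
    unfolding line_integral_def
    using assms(2) len[of b] by (intro nn_integral_cong) (auto simp: indicator_def nr)
  also have "\<dots> = (\<integral>\<^sup>+u. \<rho> (u *\<^sub>R \<theta>) * indicator {a..b} u \<partial>lborel)"
    by (subst nn_integral_real_affine[where c = 1 and t = a and f = "\<lambda>u. \<rho> (u *\<^sub>R \<theta>) * indicator {a..b} u"]) simp_all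
  finally show ?thesis .
qed

lemma curve_integral_radial_le:
  fixes \<gamma> :: "real \<Rightarrow> 'a::euclidean_space"
  assumes "\<rho> \<in> borel_measurable borel"
    and "norm \<theta> = 1" and \<gamma>: "\<And>s. s \<in> {a..b} \<Longrightarrow> \<gamma> s = s *\<^sub>R \<theta>" and "r \<le> a" "b \<le> R"
  shows "curve_integral \<rho> ({a..b}, \<gamma>) \<le> (\<integral>\<^sup>+u. \<rho> (u *\<^sub>R \<theta>) * indicator {r..R} u \<partial>lborel)"
  unfolding curve_integral_def prod.case
proof (rule SUP_least, clarify)
  fix a' b' assume ab: "a' \<le> b'" "{a'..b'} \<subseteq> {a..b}"
  have "line_integral \<rho> \<gamma> a' b' = (\<integral>\<^sup>+u. \<rho> (u *\<^sub>R \<theta>) * indicator {a'..b'} u \<partial>lborel)"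
    by (rule line_integral_radial[OF assms(1) ab(1) assms(2)]) (use ab \<gamma> in blast)
  also have "\<dots> \<le> (\<integral>\<^sup>+u. \<rho> (u *\<^sub>R \<theta>) * indicator {r..R} u \<partial>lborel)"
    using ab assms by (intro nn_integral_mono mult_left_mono) (auto simp: indicator_def)
  finally show "line_integral \<rho> \<gamma> a' b' \<le> \<dots>" .
qed

lemma locally_rectifiable_radial:
  fixes \<gamma> :: "real \<Rightarrow> 'a::real_normed_vector"
  assumes "norm \<theta> = 1" and \<gamma>: "\<And>s. s \<in> {a..b} \<Longrightarrow> \<gamma> s = s *\<^sub>R \<theta>"
  shows "locally_rectifiable ({a..b}, \<gamma>)"
  unfolding locally_rectifiable_def prod.case
proof (intro allI impI, elim conjE)
  fix a' b' assume "a' \<le> b'" "{a'..b'} \<subseteq> {a..b}"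
  then have "curve_length \<gamma> a' b' = ennreal (b' - a')"
    using assms by (intro curve_length_radial) auto
  then show "curve_length \<gamma> a' b' < \<infinity>" by simp
qed

text \<open>Beyond the last point where the ray leaves the image of the closed ball of radius \<open>r1\<close>, its lift
  stays outside that closed ball, and it cannot end inside the unit ball.\<close>

lemma radial_segment_lift:
  fixes f :: "'a::euclidean_space \<Rightarrow> 'a"
  assumes f: "open_discrete_mapping (ball 0 1) f" "continuous_on (ball 0 1) f"
    and f01: "f ` ball 0 1 \<subseteq> ball 0 1" "f 0 = 0" and r: "0 < r1" "r1 < r2" "r2 < 1"
    and m: "0 < m" "\<And>x. norm x = r1 \<Longrightarrow> m \<le> norm (f x)" and \<theta>: "norm \<theta> = 1"
  obtains t \<sigma> g where "m \<le> t" "\<sigma> \<le> 1"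
    "({t..\<sigma>}, g) \<in> joining_curves (sphere 0 r1) (sphere 0 r2) (annulus r1 r2 0)"
    "\<And>s. s \<in> {t..\<sigma>} \<Longrightarrow> f (g s) = s *\<^sub>R \<theta>"
proof -
  have op: "open_map (top_of_set (ball 0 1)) euclidean f" and disc: "\<And>y. discrete {x \<in> ball 0 1. f x = y}"
    using f(1) by (auto simp: open_discrete_mapping_def)
  have sub: "cball 0 r1 \<subseteq> ball (0::'a) 1" "cball 0 r2 \<subseteq> ball (0::'a) 1" using r by auto
  have le1: "s < 1" if "0 \<le> s" "s *\<^sub>R \<theta> \<in> f ` ball 0 1" for s
    using subsetD[OF f01(1) that(2)] that(1) \<theta> by simp
  define T where "T = {0..1} \<inter> (\<lambda>s. s *\<^sub>R \<theta>) -` (f ` cball 0 r1)"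
  have "compact (f ` cball 0 r1)"
    using continuous_on_subset[OF f(2) sub(1)] by (intro compact_continuous_image) auto
  then have "closed T"
    unfolding T_def by (intro continuous_closed_preimage continuous_intros) (auto simp: compact_imp_closed)
  then have "compact T" by (simp add: T_def bounded_Int compact_eq_bounded_closed)
  moreover have "0 \<in> T" using f01(2) r by (force simp: T_def)
  ultimately obtain t where t: "t \<in> T" "\<And>s. s \<in> T \<Longrightarrow> s \<le> t"
    using compact_attains_sup by (metis empty_iff)
  obtain x where x: "norm x \<le> r1" "f x = t *\<^sub>R \<theta>" using t(1) by (auto simp: T_def)
  have t01: "0 \<le> t" "t < 1" using t(1) le1[of t] sub(1) by (auto simp: T_def)
  have "norm x = r1"
  proof (rule ccontr)
    assume "norm x \<noteq> r1"
    then have xb: "x \<in> ball 0 r1" using x by simp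
    have "openin (top_of_set (ball 0 1)) (ball (0::'a) r1)"
      using r by (simp add: openin_open_eq subset_ball)
    then have "open (f ` ball 0 r1)" using op by (auto simp: open_map_def)
    then have "open ((\<lambda>s. s *\<^sub>R \<theta>) -` (f ` ball 0 r1))"
      by (intro open_vimage continuous_intros)
    moreover have "t \<in> (\<lambda>s. s *\<^sub>R \<theta>) -` (f ` ball 0 r1)" using x(2) xb by (metis imageI vimageI2)
    ultimately obtain e where e: "0 < e" "cball t e \<subseteq> (\<lambda>s. s *\<^sub>R \<theta>) -` (f ` ball 0 r1)"
      by (meson open_contains_cball)
    have "t + e \<in> cball t e" using e(1) by (simp add: dist_real_def)
    then have te: "(t + e) *\<^sub>R \<theta> \<in> f ` ball 0 r1" using e(2) by blast
    have sub': "f ` ball 0 r1 \<subseteq> f ` cball 0 r1" "f ` ball 0 r1 \<subseteq> f ` ball 0 1"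
      using r by (intro image_mono ball_subset_cball subset_ball; simp)+
    have "t + e < 1" using le1[of "t + e"] t01 e(1) te sub'(2) by auto
    then have "t + e \<in> T" using t01 e(1) te sub'(1) by (auto simp: T_def)
    then show False using t(2)[of "t + e"] e(1) by simp
  qed
  then have mt: "m \<le> t" using m(2)[of x] x(2) \<theta> t01 by simp
  have cl: "closure (ball (0::'a) r2) = cball 0 r2" using r by simp
  obtain g \<sigma> where g: "t < \<sigma>" "\<sigma> < 1" "continuous_on {t..\<sigma>} g" "g t = x"
    "\<And>s. s \<in> {t..\<sigma>} \<Longrightarrow> f (g s) = s *\<^sub>R \<theta>" "\<And>s. s \<in> {t..<\<sigma>} \<Longrightarrow> g s \<in> ball 0 r2" "g \<sigma> \<in> frontier (ball 0 r2)"
  proof (rule open_discrete_lift[OF op f(2) disc, of "ball 0 r2" t 1 "\<lambda>s. s *\<^sub>R \<theta>" x])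
    \<comment> \<open>The image of \<open>f\<close> lies in the open unit ball, so the point of the
      ray at radius 1 has no preimage; this forces the lift out of \<open>ball 0 r2\<close>.\<close>
    show "1 *\<^sub>R \<theta> \<notin> f ` closure (ball 0 r2)"
      unfolding cl using le1[of 1] sub(2) by (meson image_mono less_irrefl subsetD zero_le_one)
  qed (use r sub cl t01 x \<open>norm x = r1\<close> that in \<open>auto intro!: continuous_intros\<close>)
  show ?thesis
  proof (rule that[of t \<sigma> g])
    have "r1 < norm (g s)" if "s \<in> {t<..<\<sigma>}" for s
    proof (rule ccontr)
      assume "\<not> r1 < norm (g s)"
      then have "s *\<^sub>R \<theta> \<in> f ` cball 0 r1" using g(5)[of s] that by (auto intro!: image_eqI[of _ _ "g s"])
      then have "s \<in> T" using that t01 g(2) by (auto simp: T_def)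
      then show False using t(2)[of s] that by simp
    qed
    moreover have "frontier (ball (0::'a) r2) = sphere 0 r2" using r by simp
    ultimately show "({t..\<sigma>}, g) \<in> joining_curves (sphere 0 r1) (sphere 0 r2) (annulus r1 r2 0)"
      unfolding joining_curves_def annulus_def
      using g(1,3,4,6,7) \<open>norm x = r1\<close> by fastforce
  qed (use mt g in auto)
qed

text \<open>On every ray an admissible \<rho> collects at least 1 over the lifted piece, which lies
  between the radii \<open>m\<close> and 1. The outer radius \<open>r2\<close> decides where the
  piece stops but does not enter the bound.\<close>

lemma modulus_image_ring_ge:
  fixes f :: "'a::euclidean_space \<Rightarrow> 'a"
  assumes f: "open_discrete_mapping (ball 0 1) f" "continuous_on (ball 0 1) f"
    and f01: "f ` ball 0 1 \<subseteq> ball 0 1" "f 0 = 0" and r: "0 < r1" "r1 < r2" "r2 < 1"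
    and m: "0 < m" "\<And>x. norm x = r1 \<Longrightarrow> m \<le> norm (f x)" and p: "1 < p"
    and I: "0 < I" "(\<integral>\<^sup>+u. ennreal (u powr (- real (DIM('a) - 1) / (p - 1))) * indicator {m..1} u \<partial>lborel) = ennreal I"
  shows "ennreal (real DIM('a) * unit_ball_vol (real DIM('a)) * I powr (1 - p)) \<le>
    modulus p (image_curves f (joining_curves (sphere 0 r1) (sphere 0 r2) (annulus r1 r2 0)))"
  unfolding modulus_def
proof (rule INF_greatest, clarify)
  let ?\<Gamma> = "image_curves f (joining_curves (sphere 0 r1) (sphere 0 r2) (annulus r1 r2 0))"
  fix \<rho> :: "'a \<Rightarrow> ennreal" assume \<rho>: "admissible ?\<Gamma> \<rho>"
  then have meas: "\<rho> \<in> borel_measurable borel" by (simp add: admissible_def)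
  show "ennreal (real DIM('a) * unit_ball_vol (real DIM('a)) * I powr (1 - p)) \<le> (\<integral>\<^sup>+x. epow (\<rho> x) p \<partial>lebesgue)"
  proof (rule nn_integral_epow_ge_of_rays[OF meas p m(1) I])
    fix \<theta> :: 'a assume \<theta>: "norm \<theta> = 1"
    obtain t \<sigma> g where g: "m \<le> t" "\<sigma> \<le> 1"
      "({t..\<sigma>}, g) \<in> joining_curves (sphere 0 r1) (sphere 0 r2) (annulus r1 r2 0)"
      "\<And>s. s \<in> {t..\<sigma>} \<Longrightarrow> (f \<circ> g) s = s *\<^sub>R \<theta>"
      using radial_segment_lift[OF f f01 r m \<theta>] by (metis comp_apply)
    have "({t..\<sigma>}, f \<circ> g) \<in> ?\<Gamma>" using g(3) by (force simp: image_curves_def)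
    then have "1 \<le> curve_integral \<rho> ({t..\<sigma>}, f \<circ> g)"
      using \<rho> locally_rectifiable_radial[OF \<theta> g(4)] unfolding admissible_def by blast
    also have "\<dots> \<le> (\<integral>\<^sup>+u. \<rho> (u *\<^sub>R \<theta>) * indicator {m..1} u \<partial>lborel)"
      by (rule curve_integral_radial_le[OF meas \<theta> g(4,1,2)])
    finally show "1 \<le> \<dots>" .
  qed
qed

text \<open>Unlike in \<open>nn_integral_cmult\<close>, the integrand need not be measurable. This avoids the question
  whether \<open>\<psi> (norm x)\<close> is Lebesgue measurable in \<open>x\<close>.\<close>

lemma nn_integral_cmult_le:
  assumes "0 < c"
  shows "(\<integral>\<^sup>+x. ennreal c * f x \<partial>M) \<le> ennreal c * (\<integral>\<^sup>+x. f x \<partial>M)"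
  unfolding nn_integral_def[of M "\<lambda>x. ennreal c * f x"]
proof (rule SUP_least, clarify)
  fix g assume g: "simple_function M g" "g \<le> (\<lambda>x. ennreal c * f x)"
  define h where "h x = ennreal (1 / c) * g x" for x
  have [measurable]: "g \<in> borel_measurable M" using g(1) by (rule borel_measurable_simple_function)
  have c1: "ennreal c * (ennreal (1 / c) * y) = y" "ennreal (1 / c) * (ennreal c * y) = y" for y
    using assms by (simp_all add: mult.assoc[symmetric] ennreal_mult[symmetric])
  have "h x \<le> f x" for x
    using mult_left_mono[OF le_funD[OF g(2), of x], of "ennreal (1 / c)"] by (simp add: h_def c1)
  then have "(\<integral>\<^sup>+x. h x \<partial>M) \<le> (\<integral>\<^sup>+x. f x \<partial>M)" by (intro nn_integral_mono)
  moreover have "integral\<^sup>S M g = ennreal c * (\<integral>\<^sup>+x. h x \<partial>M)"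
    unfolding nn_integral_eq_simple_integral[OF g(1), symmetric]
    unfolding h_def by (subst nn_integral_cmult[symmetric]) (simp_all add: c1)
  ultimately show "integral\<^sup>S M g \<le> ennreal c * (\<integral>\<^sup>+x. f x \<partial>M)"
    by (simp add: mult_left_mono)
qed

section \<open>Upper bound for the modulus from the ring inequality\<close>

lemma epow_cmult:
  assumes "0 < c" "0 < p"
  shows "epow (ennreal c * x) p = ennreal (c powr p) * epow x p"
proof (cases x)
  case (real y)
  then show ?thesis
    using assms by (simp add: epow_def ennreal_mult[symmetric] powr_mult)
next
  case top
  then show ?thesis using assms by (simp add: epow_def ennreal_mult_top)
qed

text \<open>Since \<open>infdist\<close> to the empty set is 0 by convention, a point of the sphere
  has to be exhibited before the infimum can be estimated.\<close>

lemma infdist_frontier_ball_0: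
  assumes r: "0 < r"
  shows "r \<le> infdist (0::'a::euclidean_space) (frontier (ball 0 r))"
proof -
  obtain e :: 'a where "e \<in> Basis" using nonempty_Basis by blast
  then have "r *\<^sub>R e \<in> sphere 0 r" using r by simp
  then have "sphere (0::'a) r \<noteq> {}" by blast
  then show ?thesis using r by (auto simp: infdist_def intro!: cINF_greatest)
qed

lemma modulus_image_ring_le:
  fixes f :: "'a::euclidean_space \<Rightarrow> 'a"
  assumes ring: "ring_mapping_at p Q (ball 0 1) f 0" and p: "0 < p"
    and \<psi>: "\<psi> \<in> borel_measurable (lebesgue_on {0<..})" and r: "0 < r1" "r1 < r2" "r2 < 1"
    and K: "0 < K" "(\<integral>\<^sup>+t\<in>{r1<..<r2}. \<psi> t \<partial>lebesgue) = ennreal K"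
  shows "modulus p (image_curves f (joining_curves (sphere 0 r1) (sphere 0 r2) (annulus r1 r2 0)))
    \<le> ennreal (K powr (-p)) * (\<integral>\<^sup>+x\<in>annulus r1 r2 0. Q x * epow (\<psi> (norm x)) p \<partial>lebesgue)"
proof -
  \<comment> \<open>Normalised to integral 1 over the ring's interval of radii; the
    \<open>p\<close>-th power of the constant is the factor \<open>K powr (-p)\<close>.\<close>
  define \<eta> where "\<eta> t = ennreal (1 / K) * \<psi> t" for t
  have ep: "epow (\<eta> t) p = ennreal (K powr (-p)) * epow (\<psi> t) p" for t
    using epow_cmult[of "1 / K" p "\<psi> t"] K p by (simp add: \<eta>_def powr_divide powr_minus_divide)
  have \<psi>': "\<psi> \<in> borel_measurable (lebesgue_on {r1<..<r2})"
    by (rule measurable_restrict_mono[OF \<psi>]) (use r in auto)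
  then have "\<eta> \<in> borel_measurable (lebesgue_on {r1<..<r2})" unfolding \<eta>_def by measurable
  moreover have "(\<lambda>t. \<psi> t * indicator {r1<..<r2} t) \<in> borel_measurable lebesgue"
    using \<psi>' by (subst borel_measurable_restrict_space_iff_ennreal[symmetric]) auto
  then have "(\<integral>\<^sup>+t\<in>{r1<..<r2}. \<eta> t \<partial>lebesgue) = 1"
    using K by (simp add: \<eta>_def mult.assoc nn_integral_cmult ennreal_mult[symmetric])
  moreover have "r2 < infdist 0 (frontier (ball (0::'a) 1))"
    using r infdist_frontier_ball_0[of 1, where 'a='a] by simp
  ultimately have "modulus p (image_curves f (joining_curves (sphere 0 r1) (sphere 0 r2) (annulus r1 r2 0)))
    \<le> (\<integral>\<^sup>+x\<in>annulus r1 r2 0. Q x * epow (\<eta> (dist x 0)) p \<partial>lebesgue)"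
    using ring[unfolded ring_mapping_at_def, rule_format, of r1 r2 \<eta>] r by simp
  also have "\<dots> = (\<integral>\<^sup>+x. ennreal (K powr (-p)) * (Q x * epow (\<psi> (norm x)) p * indicator (annulus r1 r2 0) x) \<partial>lebesgue)"
    by (intro nn_integral_cong) (simp add: ep mult_ac)
  also have "\<dots> \<le> ennreal (K powr (-p)) * (\<integral>\<^sup>+x\<in>annulus r1 r2 0. Q x * epow (\<psi> (norm x)) p \<partial>lebesgue)"
    using K by (intro nn_integral_cmult_le) simp
  finally show ?thesis .
qed

text \<open>Monotone convergence as \<open>s\<close> increases to 1: it carries an estimate for
  rings with outer radius below 1 over to the full integral that defines \<open>J\<close>.\<close>

lemma nn_integral_Icc_le_of_Ioo:
  fixes g :: "real \<Rightarrow> ennreal"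
  assumes g: "g \<in> borel_measurable (lebesgue_on {0<..})" and r: "0 < r" "r < 1"
    and le: "\<And>s. r < s \<Longrightarrow> s < 1 \<Longrightarrow> (\<integral>\<^sup>+t\<in>{r<..<s}. g t \<partial>lebesgue) \<le> B"
  shows "(\<integral>\<^sup>+t\<in>{r..1}. g t \<partial>lebesgue) \<le> B"
proof -
  have meas: "(\<lambda>t. g t * indicator {r<..<s} t) \<in> borel_measurable lebesgue" for s
  proof -
    have "{r<..<s} \<subseteq> {0<..}" using r by auto
    from measurable_restrict_mono[OF g this] show ?thesis
      by (subst borel_measurable_restrict_space_iff_ennreal[symmetric]) auto
  qed
  \<comment> \<open>The \<open>k + 2\<close> keeps even the first radius strictly above
    \<open>r\<close>.\<close>
  define s where "s k = 1 - (1 - r) / real (k + 2)" for k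
  have s: "r < s k" "s k < 1" for k
  proof -
    have "(1 - r) / real (k + 2) < (1 - r) / 1" using r by (intro divide_strict_left_mono) auto
    then show "r < s k" by (simp add: s_def)
    show "s k < 1" using r by (simp add: s_def)
  qed
  have "(1 - r) / real (k' + 2) \<le> (1 - r) / real (k + 2)" if "k \<le> k'" for k k'
    using r that by (intro divide_left_mono) auto
  then have smono: "s k \<le> s k'" if "k \<le> k'" for k k' using that by (simp add: s_def)
  have "s \<longlonglongrightarrow> 1 - 0"
    unfolding s_def by (intro tendsto_diff tendsto_const tendsto_divide_0[OF tendsto_const]
      filterlim_at_top_imp_at_infinity filterlim_compose[OF filterlim_real_sequentially filterlim_add_const_nat_at_top])
  then have ev: "\<exists>k. t < s k" if "t < 1" for t
    using order_tendstoD(1)[of s 1 sequentially t] that eventually_happens by fastforce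
  have "(\<integral>\<^sup>+t\<in>{r..1}. g t \<partial>lebesgue) = (\<integral>\<^sup>+t. (SUP k. g t * indicator {r<..<s k} t) \<partial>lebesgue)"
  proof (rule nn_integral_cong_AE)
    have "AE t in lebesgue. t \<noteq> r" "AE t in lebesgue. t \<noteq> 1"
      by (rule AE_completion, rule AE_lborel_singleton)+
    then show "AE t in lebesgue. g t * indicator {r..1} t = (SUP k. g t * indicator {r<..<s k} t)"
    proof eventually_elim
      case (elim t)
      show ?case
      proof (cases "r < t \<and> t < 1")
        case True
        then obtain k where "t < s k" using ev by blast
        then have "(SUP k. g t * indicator {r<..<s k} t) = g t"
          using True by (intro antisym SUP_least SUP_upper2[of k]) (auto simp: indicator_def)
        then show ?thesis using True by simp
      next
        case False
        then have "t \<notin> {r<..<s k}" for k using s(2)[of k] by auto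
        then have "(\<lambda>k. g t * indicator {r<..<s k} t) = (\<lambda>_. 0)" by (simp add: fun_eq_iff)
        moreover have "t \<notin> {r..1}" using False elim by auto
        ultimately show ?thesis by (simp only: indicator_simps) simp
      qed
    qed
  qed
  also have "\<dots> = (SUP k. \<integral>\<^sup>+t. g t * indicator {r<..<s k} t \<partial>lebesgue)"
  proof (rule nn_integral_monotone_convergence_SUP[OF _ meas])
    show "incseq (\<lambda>k t. g t * indicator {r<..<s k} t)"
      unfolding incseq_def le_fun_def
      by (intro allI impI mult_left_mono) (use smono in \<open>auto simp: indicator_def dest: less_le_trans\<close>)
  qed
  also have "\<dots> \<le> B" by (intro SUP_least le s)
  finally show ?thesis .
qed

text \<open>For the integral \<open>K\<close> of \<psi> up to \<open>s < 1\<close>, the two modulus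
  bounds give \<open>A * I powr (1 - p) \<le> K powr (-p) * (c * j powr \<alpha>)\<close>. Only
  \<open>K\<close> depends on \<open>s\<close>, so \<open>K\<close> may be replaced by its limit
  \<open>j\<close>.\<close>

lemma ring_mapping_minimum_modulus:
  fixes f :: "'a::euclidean_space \<Rightarrow> 'a" and p c \<alpha> j :: real
  assumes f: "open_discrete_mapping (ball 0 1) f" "continuous_on (ball 0 1) f"
    and f01: "f ` ball 0 1 \<subseteq> ball 0 1" "f 0 = 0"
    and ring: "ring_mapping_at p Q (ball 0 1) f 0" and p: "1 < p"
    and \<psi>: "\<psi> \<in> borel_measurable (lebesgue_on {0<..})" and r: "0 < r" "r < 1"
    and j: "(\<integral>\<^sup>+t\<in>{r..1}. \<psi> t \<partial>lebesgue) = ennreal j" "0 < j" and c: "0 < c"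
    and Q: "(\<integral>\<^sup>+x\<in>annulus r 1 0. Q x * epow (\<psi> (norm x)) p \<partial>lebesgue) \<le> ennreal (c * j powr \<alpha>)"
    and m: "0 < m" "\<And>x. norm x = r \<Longrightarrow> m \<le> norm (f x)"
    and I: "0 < I" "(\<integral>\<^sup>+u. ennreal (u powr (- real (DIM('a) - 1) / (p - 1))) * indicator {m..1} u \<partial>lborel) = ennreal I"
  shows "real DIM('a) * unit_ball_vol (real DIM('a)) * j powr (p - \<alpha>) \<le> c * I powr (p - 1)"
proof -
  define A where "A = real DIM('a) * unit_ball_vol (real DIM('a))"
  have A: "0 < A" by (simp add: A_def)
  \<comment> \<open>The bound for \<open>K powr p\<close> obtained by solving the comparison of the
    two moduli.\<close>
  define M where "M = c * j powr \<alpha> * I powr (p - 1) / A"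
  have M: "0 < M" using A c j I by (simp add: M_def)
  have "(\<integral>\<^sup>+t\<in>{r..1}. \<psi> t \<partial>lebesgue) \<le> ennreal (M powr (1 / p))"
  proof (rule nn_integral_Icc_le_of_Ioo[OF \<psi> r])
    fix s assume s: "r < s" "s < 1"
    have "(\<integral>\<^sup>+t\<in>{r<..<s}. \<psi> t \<partial>lebesgue) \<le> (\<integral>\<^sup>+t\<in>{r..1}. \<psi> t \<partial>lebesgue)"
      using s by (intro nn_integral_mono mult_left_mono) (auto simp: indicator_def)
    then have "(\<integral>\<^sup>+t\<in>{r<..<s}. \<psi> t \<partial>lebesgue) \<noteq> top" using j by (auto simp: top_unique)
    then obtain K where K: "0 \<le> K" "(\<integral>\<^sup>+t\<in>{r<..<s}. \<psi> t \<partial>lebesgue) = ennreal K"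
      by (cases "\<integral>\<^sup>+t\<in>{r<..<s}. \<psi> t \<partial>lebesgue") auto
    have "K \<le> M powr (1 / p)"
    \<comment> \<open>Where \<psi> vanishes almost everywhere up to \<open>s\<close>, it cannot be
      normalised, but the bound on \<open>K\<close> is then trivial.\<close>
    proof (cases "K = 0")
      case False
      then have K0: "0 < K" using K by simp
      have "ennreal (A * I powr (1 - p)) \<le> modulus p (image_curves f (joining_curves (sphere 0 r) (sphere 0 s) (annulus r s 0)))"
        unfolding A_def by (rule modulus_image_ring_ge[OF f f01 r(1) s m p I])
      also have "\<dots> \<le> ennreal (K powr (-p)) * (\<integral>\<^sup>+x\<in>annulus r s 0. Q x * epow (\<psi> (norm x)) p \<partial>lebesgue)"
        by (rule modulus_image_ring_le[OF ring _ \<psi> r(1) s K0 K(2)]) (use p in simp)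
      also have "\<dots> \<le> ennreal (K powr (-p)) * (\<integral>\<^sup>+x\<in>annulus r 1 0. Q x * epow (\<psi> (norm x)) p \<partial>lebesgue)"
        using s by (intro mult_left_mono nn_integral_mono) (auto simp: indicator_def annulus_def)
      also have "\<dots> \<le> ennreal (K powr (-p)) * ennreal (c * j powr \<alpha>)" by (intro mult_left_mono Q) simp
      finally have "A * I powr (1 - p) \<le> K powr (-p) * (c * j powr \<alpha>)"
        using c by (simp add: ennreal_mult[symmetric])
      then have "(K powr p * I powr (p - 1)) * (A * I powr (1 - p)) \<le> (K powr p * I powr (p - 1)) * (K powr (-p) * (c * j powr \<alpha>))"
        by (rule mult_left_mono) simp
      also have "(K powr p * I powr (p - 1)) * (A * I powr (1 - p)) = K powr p * A"
        using I by (simp add: powr_add[symmetric] mult_ac)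
      also have "(K powr p * I powr (p - 1)) * (K powr (-p) * (c * j powr \<alpha>)) = c * j powr \<alpha> * I powr (p - 1)"
        using K0 by (simp add: powr_add[symmetric] mult_ac)
      finally have "K powr p \<le> M" using A by (simp add: M_def field_simps)
      then have "(K powr p) powr (1 / p) \<le> M powr (1 / p)" using p by (intro powr_mono2) auto
      then show ?thesis using K0 p by (simp add: powr_powr)
    qed simp
    then show "(\<integral>\<^sup>+t\<in>{r<..<s}. \<psi> t \<partial>lebesgue) \<le> ennreal (M powr (1 / p))" using K by (simp add: ennreal_leI)
  qed
  then have "j \<le> M powr (1 / p)" using j by simp
  then have "j powr p \<le> (M powr (1 / p)) powr p" using j p by (intro powr_mono2) auto
  then have "j powr p \<le> M" using M p by (simp add: powr_powr)
  then have "A * j powr p \<le> c * j powr \<alpha> * I powr (p - 1)" using A by (simp add: M_def field_simps)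
  then show ?thesis using j by (simp add: A_def powr_diff field_simps)
qed

section \<open>Passage to the lower limit at the origin\<close>

lemma Liminf_at_0_le_1:
  fixes g :: "'a::euclidean_space \<Rightarrow> real"
  assumes "\<And>r. 0 < r \<Longrightarrow> r < 1 \<Longrightarrow> \<exists>x. norm x = r \<and> g x \<le> 1"
  shows "Liminf (at 0) (\<lambda>x. ereal (g x)) \<le> 1"
proof (rule ccontr)
  assume "\<not> ?thesis"
  then have "\<forall>\<^sub>F x in at 0. 1 < ereal (g x)" by (intro less_LiminfD) simp
  then obtain d where d: "0 < d" "\<And>x. x \<noteq> 0 \<Longrightarrow> norm x < d \<Longrightarrow> 1 < ereal (g x)"
    unfolding eventually_at by (auto simp: dist_norm)
  have "0 < min (d/2) (1/2)" "min (d/2) (1/2) < (1::real)" using d(1) by auto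
  from assms[OF this] obtain x where x: "norm x = min (d/2) (1/2)" "g x \<le> 1" by blast
  have "x \<noteq> 0" "norm x < d" using x(1) d(1) by auto
  then show False using d(2)[of x] x(2) by simp
qed

theorem theorem2:
  fixes f :: "real ^ 'n \<Rightarrow> real ^ 'n"
    and Q :: "real ^ 'n \<Rightarrow> ennreal"
    and \<psi> :: "real \<Rightarrow> ennreal"
    and J :: "real \<Rightarrow> real"
    and p \<alpha> c n \<omega> :: real
  assumes "CARD('n) \<ge> 2" and "p \<ge> 1"
    and "n = real CARD('n)" and "\<omega> = unit_sphere_area TYPE(real ^ 'n)"
    and "Q \<in> borel_measurable (lebesgue_on (ball 0 1))"
    and "f ` ball 0 1 \<subseteq> ball 0 1" and "open_discrete_mapping (ball 0 1) f"
    and "ring_mapping p Q (ball 0 1) f" and "f 0 = 0"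
    and "AE r\<in>{0<..<1} in lebesgue. spherical_mean Q r \<noteq> \<infinity>"
    and "c > 0" and "\<alpha> \<le> p"
    and "\<psi> \<in> borel_measurable (lebesgue_on {0<..})"
    and "\<And>r. 0 < r \<Longrightarrow> r < 1 \<Longrightarrow> (\<integral>\<^sup>+t\<in>{r..1}. \<psi> t \<partial>lebesgue) = ennreal (J r) \<and> 0 < J r"
    and "\<And>r. 0 < r \<Longrightarrow> r < 1 \<Longrightarrow>
           (\<integral>\<^sup>+x\<in>annulus r 1 0. Q x * epow (\<psi> (norm x)) p \<partial>lebesgue) \<le> ennreal (c * J r powr \<alpha>)"
  shows "(1 < p \<and> p < n \<longrightarrow>
           (let \<beta> = (n - p) / (p - 1) * (\<omega> / c) powr (1 / (p - 1)) in
            Liminf (at 0) (\<lambda>x. ereal (norm (f x) *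
              (1 + \<beta> * J (norm x) powr ((p - \<alpha>) / (p - 1))) powr ((p - 1) / (n - p)))) \<le> 1)) \<and>
         (p = n \<longrightarrow>
           (let \<gamma> = n * (\<omega> / c) powr (1 / (n - 1)) in
            Liminf (at 0) (\<lambda>x. ereal (norm (f x) *
              exp (\<gamma> / n * J (norm x) powr ((n - \<alpha>) / (n - 1))))) \<le> 1))"
proof -
  define A where "A = n * unit_ball_vol n"
  have A: "0 < A" using assms(1) by (simp add: A_def assms(3))
  have \<omega>: "0 \<le> \<omega>" "\<omega> \<le> A"
    using unit_sphere_area_le[where 'n='n] by (simp_all add: assms(3,4) A_def unit_sphere_area_def)
  have cont: "continuous_on (ball 0 1) f" and ring: "ring_mapping_at p Q (ball 0 1) f 0"
    using assms(8) by (auto simp: ring_mapping_def)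
  \<comment> \<open>The common core of both claims: times \<open>(n - p) / (p - 1)\<close> it is the
    term with \<beta>, and for \<open>p = n\<close> it is the argument of the exponential.\<close>
  define S where "S r = (\<omega> / c) powr (1 / (p - 1)) * J r powr ((p - \<alpha>) / (p - 1))" for r
  have S0: "0 \<le> S r" for r by (simp add: S_def)
  have key: "\<exists>x. norm x = r \<and> norm (f x) < 1 \<and> (0 < norm (f x) \<longrightarrow> (\<forall>I. 0 < I \<longrightarrow>
      (\<integral>\<^sup>+u. ennreal (u powr (- (n - 1) / (p - 1))) * indicator {norm (f x)..1} u \<partial>lborel) = ennreal I \<longrightarrow>
      S r \<le> I))" if p: "1 < p" and r: "0 < r" "r < 1" for r
  proof -
    have sub: "sphere 0 r \<subseteq> ball (0 :: real ^ 'n) 1" using r by auto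
    obtain e :: "real ^ 'n" where "e \<in> Basis" using nonempty_Basis by blast
    then have "r *\<^sub>R e \<in> sphere 0 r" using r by simp
    moreover have "continuous_on (sphere 0 r) (\<lambda>x. norm (f x))"
      using continuous_on_subset[OF cont sub] by (rule continuous_on_norm)
    ultimately obtain x where x: "x \<in> sphere 0 r" "\<And>y. y \<in> sphere 0 r \<Longrightarrow> norm (f x) \<le> norm (f y)"
      using continuous_attains_inf[OF compact_sphere, of 0 r "\<lambda>x. norm (f x)"] by blast
    have "f x \<in> ball 0 1" using assms(6) x(1) sub by blast
    moreover have "S r \<le> I" if fx: "0 < norm (f x)" and I: "0 < I"
      "(\<integral>\<^sup>+u. ennreal (u powr (- (n - 1) / (p - 1))) * indicator {norm (f x)..1} u \<partial>lborel) = ennreal I" for I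
    proof -
      have n1: "real (DIM(real ^ 'n) - 1) = n - 1" using assms(1,3) by (simp add: of_nat_diff)
      have "A * J r powr (p - \<alpha>) \<le> c * I powr (p - 1)"
        using ring_mapping_minimum_modulus[OF assms(7) cont assms(6,9) ring p assms(13) r
            assms(14)[OF r, THEN conjunct1] assms(14)[OF r, THEN conjunct2] assms(11) assms(15)[OF r] fx _ I(1)]
          x(2) I(2) n1 by (simp add: A_def assms(3))
      \<comment> \<open>Here the constant \<open>A\<close> from integration along rays is exchanged
        for the smaller \<omega>.\<close>
      moreover have "\<omega> * J r powr (p - \<alpha>) \<le> A * J r powr (p - \<alpha>)"
        using \<omega> by (intro mult_right_mono) auto
      ultimately have "\<omega> / c * J r powr (p - \<alpha>) \<le> I powr (p - 1)"
        using assms(11) by (simp add: field_simps)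
      then have "(\<omega> / c * J r powr (p - \<alpha>)) powr (1 / (p - 1)) \<le> (I powr (p - 1)) powr (1 / (p - 1))"
        using p \<omega> assms(11) by (intro powr_mono2) auto
      moreover have "(\<omega> / c * J r powr (p - \<alpha>)) powr (1 / (p - 1)) = S r"
        unfolding S_def using \<omega> assms(11) by (subst powr_mult) (auto simp: powr_powr)
      ultimately show ?thesis
        using p I by (simp add: powr_powr)
    qed
    ultimately show ?thesis using x(1) by (intro exI[of _ x]) auto
  qed
  have FTC: "(\<integral>\<^sup>+u. ennreal (g u) * indicator {m..1} u \<partial>lborel) = ennreal (G 1 - G m)"
    if "0 < m" "m < 1" "g \<in> borel_measurable borel" "\<And>u. 0 < u \<Longrightarrow> 0 \<le> g u"
      "\<And>u. 0 < u \<Longrightarrow> (G has_real_derivative g u) (at u)" for m and g G :: "real \<Rightarrow> real"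
    using that by (intro nn_integral_FTC_Icc) auto
  have "Liminf (at 0) (\<lambda>x. ereal (norm (f x) *
      (1 + ((n - p) / (p - 1) * (\<omega> / c) powr (1 / (p - 1))) * J (norm x) powr ((p - \<alpha>) / (p - 1))) powr ((p - 1) / (n - p)))) \<le> 1"
    if p: "1 < p" "p < n"
  proof (rule Liminf_at_0_le_1)
    fix r :: real assume r: "0 < r" "r < 1"
    define e where "e = (n - p) / (p - 1)"
    have e: "0 < e" using p by (simp add: e_def)
    obtain x where x: "norm x = r" "norm (f x) < 1" "\<And>I. 0 < norm (f x) \<Longrightarrow> 0 < I \<Longrightarrow>
      (\<integral>\<^sup>+u. ennreal (u powr (- (n - 1) / (p - 1))) * indicator {norm (f x)..1} u \<partial>lborel) = ennreal I \<Longrightarrow> S r \<le> I"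
      using key[OF p(1) r] by blast
    have "norm (f x) * (1 + e * S r) powr (1 / e) \<le> 1"
    proof (cases "f x = 0")
      case False
      define m where "m = norm (f x)"
      have m: "0 < m" "m < 1" using False x(2) by (simp_all add: m_def)
      \<comment> \<open>The integral of \<open>u powr (- e - 1)\<close> over \<open>{m..1}\<close>;
        the choice of \<open>e\<close> makes this exponent equal to
        \<open>- (n - 1) / (p - 1)\<close>.\<close>
      define I where "I = (m powr (- e) - 1) / e"
      have "m powr 0 < m powr (- e)" using m e by (intro powr_less_mono') auto
      then have I: "0 < I" using m e by (simp add: I_def)
      have ex: "- (n - 1) / (p - 1) = - e - 1" using p by (simp add: e_def field_simps)
      have "(\<integral>\<^sup>+u. ennreal (u powr (- (n - 1) / (p - 1))) * indicator {m..1} u \<partial>lborel) =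
          ennreal (- (1 powr (- e)) / e - - (m powr (- e)) / e)"
        unfolding ex
      proof (rule FTC[OF m])
        show "((\<lambda>u. - (u powr (- e)) / e) has_real_derivative u powr (- e - 1)) (at u)" if "0 < u" for u
          using that e by (auto intro!: derivative_eq_intros)
      qed auto
      also have "- (1 powr (- e)) / e - - (m powr (- e)) / e = I" using e by (simp add: I_def diff_divide_distrib)
      finally have "S r \<le> I" using x(3) I m by (simp add: m_def)
      then have "1 + e * S r \<le> m powr (- e)" using e by (simp add: I_def field_simps)
      then have "(1 + e * S r) powr (1 / e) \<le> (m powr (- e)) powr (1 / e)"
        using e S0[of r] by (intro powr_mono2) auto
      also have "\<dots> = 1 / m" using m e by (simp add: powr_powr powr_neg_one)
      finally show ?thesis using m by (simp add: m_def field_simps)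
    qed simp
    moreover have "1 / e = (p - 1) / (n - p)" by (simp add: e_def)
    ultimately show "\<exists>x. norm x = r \<and> norm (f x) *
      (1 + ((n - p) / (p - 1) * (\<omega> / c) powr (1 / (p - 1))) * J (norm x) powr ((p - \<alpha>) / (p - 1))) powr ((p - 1) / (n - p)) \<le> 1"
      using x(1) by (intro exI[of _ x]) (simp add: S_def e_def mult.assoc)
  qed
  moreover have "Liminf (at 0) (\<lambda>x. ereal (norm (f x) *
      exp (n * (\<omega> / c) powr (1 / (n - 1)) / n * J (norm x) powr ((n - \<alpha>) / (n - 1))))) \<le> 1"
    if pn: "p = n"
  proof (rule Liminf_at_0_le_1)
    fix r :: real assume r: "0 < r" "r < 1"
    have n: "1 < n" "1 < p" using assms(1,3) pn by auto
    obtain x where x: "norm x = r" "norm (f x) < 1" "\<And>I. 0 < norm (f x) \<Longrightarrow> 0 < I \<Longrightarrow>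
      (\<integral>\<^sup>+u. ennreal (u powr (- (n - 1) / (p - 1))) * indicator {norm (f x)..1} u \<partial>lborel) = ennreal I \<Longrightarrow> S r \<le> I"
      using key[OF n(2) r] by blast
    have "norm (f x) * exp (S r) \<le> 1"
    proof (cases "f x = 0")
      case False
      define m where "m = norm (f x)"
      have m: "0 < m" "m < 1" using False x(2) by (simp_all add: m_def)
      \<comment> \<open>At \<open>p = n\<close> the integrand is \<open>1 / u\<close>, so the
        logarithm takes the place of the power and \<open>I = - ln m\<close>.\<close>
      have ex: "- (n - 1) / (p - 1) = - 1" using n pn by (simp add: field_simps)
      have "(\<integral>\<^sup>+u. ennreal (u powr (- (n - 1) / (p - 1))) * indicator {m..1} u \<partial>lborel) = ennreal (ln 1 - ln m)"
        unfolding ex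
      proof (rule FTC[OF m])
        show "(ln has_real_derivative u powr (- 1)) (at u)" if "0 < u" for u
          using that by (auto intro!: derivative_eq_intros simp: powr_minus_divide)
      qed auto
      then have "S r \<le> - ln m" using x(3)[of "- ln m"] m by (simp add: m_def)
      then have "exp (S r) \<le> exp (- ln m)" by simp
      also have "\<dots> = 1 / m" using m by (simp add: exp_minus divide_inverse)
      finally show ?thesis using m by (simp add: m_def field_simps)
    qed simp
    then show "\<exists>x. norm x = r \<and> norm (f x) *
      exp (n * (\<omega> / c) powr (1 / (n - 1)) / n * J (norm x) powr ((n - \<alpha>) / (n - 1))) \<le> 1"
      using x(1) n pn by (intro exI[of _ x]) (simp add: S_def)
  qed
  ultimately show ?thesis unfolding Let_def by blast
qed

end
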